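(* Let $\mathcal K$ be a field with $\mathrm{char}(\mathcal K)\neq 2$ and $\Lambda=\mathcal K Q/\langle\rho\rangle$ a zero-relation algebra. (A) Suppose $T$ is a tree of the following shape: $T_0$ is the disjoint union of the vertex sets of subtrees $T^0,T^1,\dots,T^k$ of $T$, with a vertex $0\in T^0_0$ and vertices $j\in T^j_0$ for $1\le j\le k$, and the arrows of $T$ are the arrows of $T^0,\dots,T^k$ together with arrows $0\xrightarrow{a_j}j$ for $1\leq j\leq k$. Denote by $\overline T^j$ the subtree of $T$ induced by $T^j_0\cup\{0\}$ for each $1\leq j\leq k$. Suppose further that $F:T\to(Q,\rho)$ is a bound quiver morphism satisfying: (1) for every $1\le j\le k$, $F(c)\neq F(d)$ whenever $c,d\in\overline T^j_1$ with $c\neq d$, and $s(c)=s(d)$ or $t(c)=t(d)$; (2) $F(a_1)=F(a_j)$ for all $1\leq j\leq k$, and if $b\in T_1$ with $s(b)=0$ and $F(b)=F(a_1)$ then $b=a_j$ for some $1\leq j\leq k$. Let $M:=F_\lambda(V_T)$. If there exist distinct $n_1,n_2\in\{1,\dots,k\}$ and a generalised graph map $\mathcal G$ from $M$ to $M$ with $(n_1,n_2)\in\pi(\mathcal G_0)$, then $M$ is decomposable. (B) Suppose $T$ is a tree of the same shape as in (A) but with the direction of $a_j$ reversed for every $j\in\{1,\dots,k\}$, i.e. with arrows $j\xrightarrow{a_j}0$. Denote by $\overline T^j$ the subtree of $T$ induced by $T^j_0\cup\{0\}$ for each $1\leq j\leq k$. Suppose $F:T\to(Q,\rho)$ is a bound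 quiver morphism satisfying: (1) for every $1\le j\le k$, $F(c)\neq F(d)$ whenever $c,d\in\overline T^j_1$ with $c\neq d$, and $s(c)=s(d)$ or $t(c)=t(d)$; (2) $F(a_1)=F(a_j)$ for all $1\leq j\leq k$, and if $b\in T_1$ with $t(b)=0$ and $F(b)=F(a_1)$ then $b=a_j$ for some $1\leq j\leq k$. Let $M:=F_\lambda(V_T)$. If there exist distinct $n_1,n_2\in\{1,\dots,k\}$ and a generalised graph map $\mathcal G$ from $M$ to $M$ with $(n_1,n_2)\in\pi(\mathcal G_0)$, then $M$ is decomposable.
   Context: **Setting.** $\mathcal K$ is a field with $\mathrm{char}(\mathcal K)\neq 2$. $Q=(Q_0,Q_1)$ is a locally finite quiver, $\rho$ is a set of paths in $Q$ of length at least $2$ such that for each $v\in Q_0$ there is $n\ge 0$ such that $\langle\rho\rangle$ contains all paths of length exceeding $n$ with source or target $v$; $\Lambda:=\mathcal K Q/\langle\rho\rangle$ is called a zero-relation algebra. Finite-dimensional left $\Lambda$-modules are identified with finite-dimensional bound $\mathcal K$-representations of $(Q,\rho)$. A tree is a finite quiver $T=(T_0,T_1,s,t)$ whose underlying undirected graph is simply connected (a tree); $T_0\subset\mathbb N$. A bound quiver morphism $F:T\to(Q,\rho)$ is a quiver morphism $T\to Q$ such that no path $p$ in $T$ has $F(p)\in\langle\rho\rangle$. The associated generalised tree module $F_\lambda(V_T)$ is the $\Lambda$-module with $\mathcal K$-basis $\{v_n\mid n\in T_0\}$, where $v_n$ lies in the vector space at the vertex $F(n)$, and each arrow $\gamma\in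 Q_1$ acts by $\gamma\cdot v_n=\sum_{a\in T_1,\ s(a)=n,\ F(a)=\gamma}v_{t(a)}$. The following is specialised to the pair $(M,M)$ with $M=F_\lambda(V_T)$. **Networks.** A network consists of a quiver together with a set of undirected edges forming a simple graph on the same vertex set. A subnetwork consists of subsets of the vertices, arrows and edges such that all endpoints of the chosen arrows and edges are chosen. It is connected if its underlying undirected graph is connected. A link between two vertices is an arrow (in either direction) or an edge joining them. The pullback network $\mathcal N[1]$ of $(M,M)$ has vertices $(n,m)\in T_0\times T_0$ with $F(n)=F(m)$; arrows $(n,m)\xrightarrow{(a,b)}(n',m')$ for arrows $n\xrightarrow{a}n'$ and $m\xrightarrow{b}m'$ in $T$ with $F(a)=F(b)$; and edge set $\mathcal E^1$ consisting of all $\{(n,m),(n',m)\}$ such that $n\neq n'$ and there are arrows $n\xleftarrow{a}n''\xrightarrow{b}n'$ in $T$ with $F(a)=F(b)$, and all $\{(n,m),(n,m')\}$ such that $m\ne m'$ and there are arrows $m\xrightarrow{c}m''\xleftarrow{d}m'$ in $T$ with $F(c)=F(d)$. The 2-covering network $\mathcal N[2]$ has vertices $(n,m,j)$ with $(n,m)\in\mathcal N[1]_0$, $j\in\{-1,1\}$; arrows $(n,m,j)\xrightarrow{(a,b,j)}(n',m',j)$ for each arrow $(n,m)\xrightarrow{(a,b)}(n',m')$ of $\mathcal N[1]$ and $j\in\{-1,1\}$; and edges $\{(n,m,j),(n',m',-j)\}$ for each $\{(n,m),(n',m')\}\in\mathcal E^1$ and $j\in\{-1,1\}$. $\pi:\mathcal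 N[2]\to\mathcal N[1]$ denotes the projection forgetting the sign $j$. **Properties of a subnetwork $\mathcal M=(\mathcal M_0,\mathcal M_1,\mathcal E_{\mathcal M})$ (vertices, arrows, edges) of $\mathcal N[2]$.** *Complete*: for each $(n,m,j)\in\mathcal M_0$: (i) for every arrow $n'\xrightarrow{a}n$ in $T$, at least one of: (ia) there is $m'\xrightarrow{b}m$ in $T$ with $((n',m',j)\xrightarrow{(a,b,j)}(n,m,j))\in\mathcal M_1$; (ib) there are $n\xleftarrow{a}n'\xrightarrow{c}n''$ in $T$ with $F(a)=F(c)$ and $(n'',m,-j)\in\mathcal M_0$ such that $\{(n,m,j),(n'',m,-j)\}\in\mathcal E_{\mathcal M}$; (ii) for every arrow $m\xrightarrow{b}m'$ in $T$, at least one of: (iia) there is $n\xrightarrow{a}n'$ in $T$ with $((n,m,j)\xrightarrow{(a,b,j)}(n',m',j))\in\mathcal M_1$; (iib) there are $m\xrightarrow{b}m'\xleftarrow{d}m''$ in $T$ with $F(b)=F(d)$ and $(n,m'',-j)\in\mathcal M_0$ such that $\{(n,m,j),(n,m'',-j)\}\in\mathcal E_{\mathcal M}$. *$\mathcal R[2]$-free*: there are no vertices $x,y,z$ of $\mathcal M$ such that $\mathcal M$ contains a link between $x$ and $y$ and a link between $y$ and $z$, and $\pi(x),\pi(y),\pi(z)$ are three distinct vertices of $\mathcal N[1]$ that are pairwise joined by links in $\mathcal N[1]$ (i.e. form a triangle). *Involution-free*: $(n,m,j)\in\mathcal M_0$ implies $(n,m,-j)\notin\mathcal M_0$. A *generalised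 graph map* $\mathcal G$ from $M$ to $M$ is a non-empty connected involution-free complete $\mathcal R[2]$-free subnetwork of $\mathcal N[2]$; $\mathcal G_0$ is its vertex set. *)

theory Defs
  imports
    "Graph_Theory.Graph_Theory"
    "HOL-Library.Poly_Mapping"
begin

section \<open>Quivers, path algebras and zero-relation ideals\<close>

text \<open>
  Quivers are the well-formed multidigraphs of the library: loops and parallel arrows are
  allowed, \<^const>\<open>tail\<close> is the source and \<^const>\<open>head\<close> the target of an arrow.
\<close>

definition locally_finite :: "('v,'q) pre_digraph \<Rightarrow> bool" where
  "locally_finite Q \<longleftrightarrow> (\<forall>v\<in>verts Q. finite (out_arcs Q v) \<and> finite (in_arcs Q v))"

text \<open>
  A path is a triple (source, arrows in order of traversal, target); the trivial path at
  \<open>v\<close> is \<open>(v, [], v)\<close>.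
\<close>

type_synonym ('v,'q) qpath = "'v \<times> 'q list \<times> 'v"

definition qpaths :: "('v,'q) pre_digraph \<Rightarrow> ('v,'q) qpath set" where
  "qpaths Q = {(u, p, v). pre_digraph.awalk Q u p v}"

definition path_algebra :: "('v,'q) pre_digraph \<Rightarrow> (('v,'q) qpath \<Rightarrow>\<^sub>0 'k::field) set" where
  "path_algebra Q = {x. Poly_Mapping.keys x \<subseteq> qpaths Q}"

text \<open>
  Left modules are representations, so in a product of two paths the right factor is
  traversed first.
\<close>

definition path_mult ::
    "(('v,'q) qpath \<Rightarrow>\<^sub>0 'k::field) \<Rightarrow> (('v,'q) qpath \<Rightarrow>\<^sub>0 'k) \<Rightarrow> (('v,'q) qpath \<Rightarrow>\<^sub>0 'k)" where
  "path_mult x y =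
     (\<Sum>(u, p, v) \<in> Poly_Mapping.keys x. \<Sum>(u', p', v') \<in> Poly_Mapping.keys y.
        if v' = u
        then Poly_Mapping.single (u', p' @ p, v)
               (Poly_Mapping.lookup x (u, p, v) * Poly_Mapping.lookup y (u', p', v'))
        else 0)"

text \<open>
  The path algebra has no unit when the quiver has infinitely many vertices, so ideals are
  defined here and not taken from \<open>HOL-Algebra\<close>. Closure under scalars is automatic: every
  element is fixed by the finite sum of the trivial paths at the targets of its paths.
\<close>

definition two_sided_ideal ::
    "('v,'q) pre_digraph \<Rightarrow> (('v,'q) qpath \<Rightarrow>\<^sub>0 'k::field) set \<Rightarrow> bool" where
  "two_sided_ideal Q I \<longleftrightarrow>
     I \<subseteq> path_algebra Q \<and> 0 \<in> I \<and>
     (\<forall>x\<in>I. \<forall>y\<in>I. x + y \<in> I) \<and> (\<forall>x\<in>I. - x \<in> I) \<and>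
     (\<forall>r\<in>path_algebra Q. \<forall>x\<in>I. path_mult r x \<in> I \<and> path_mult x r \<in> I)"

definition relation_ideal ::
    "('v,'q) pre_digraph \<Rightarrow> ('v,'q) qpath set \<Rightarrow> (('v,'q) qpath \<Rightarrow>\<^sub>0 'k::field) set" where
  "relation_ideal Q \<rho> =
     \<Inter> {I. two_sided_ideal Q I \<and> (\<forall>p\<in>\<rho>. Poly_Mapping.single p 1 \<in> I)}"

definition in_relation_ideal ::
    "'k::field itself \<Rightarrow> ('v,'q) pre_digraph \<Rightarrow> ('v,'q) qpath set \<Rightarrow> ('v,'q) qpath \<Rightarrow> bool" where
  "in_relation_ideal K Q \<rho> p \<longleftrightarrow> Poly_Mapping.single p (1::'k) \<in> relation_ideal Q \<rho>"

text \<open>The pairs \<open>(Q, \<rho>)\<close> for which \<open>KQ/\<langle>\<rho>\<rangle>\<close> is a zero-relation algebra.\<close>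

definition zero_relation_quiver ::
    "'k::field itself \<Rightarrow> ('v,'q) pre_digraph \<Rightarrow> ('v,'q) qpath set \<Rightarrow> bool" where
  "zero_relation_quiver K Q \<rho> \<longleftrightarrow>
     wf_digraph Q \<and> locally_finite Q \<and>
     \<rho> \<subseteq> qpaths Q \<and> (\<forall>(u, p, v)\<in>\<rho>. 2 \<le> length p) \<and>
     (\<forall>w\<in>verts Q. \<exists>n::nat. \<forall>(u, p, v)\<in>qpaths Q.
        (u = w \<or> v = w) \<and> n < length p \<longrightarrow> in_relation_ideal K Q \<rho> (u, p, v))"


section \<open>Bound representations\<close>

text \<open>
  The spaces at the vertices are subspaces of one ambient vector space with scalar
  multiplication \<open>scl\<close>; an arrow acts by the restriction of a map on the ambient type.
\<close>

record ('k,'v,'q,'m) rep =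
  scl :: "'k \<Rightarrow> 'm \<Rightarrow> 'm"
  space :: "'v \<Rightarrow> 'm set"
  act :: "'q \<Rightarrow> 'm \<Rightarrow> 'm"

definition bound_rep ::
    "('v,'q) pre_digraph \<Rightarrow> ('v,'q) qpath set \<Rightarrow> ('k::field,'v,'q,'m::ab_group_add) rep \<Rightarrow> bool" where
  "bound_rep Q \<rho> M \<longleftrightarrow>
     vector_space (scl M) \<and>
     (\<forall>v\<in>verts Q. module.subspace (scl M) (space M v)) \<and>
     (\<forall>\<gamma>\<in>arcs Q. \<forall>x\<in>space M (tail Q \<gamma>).
        act M \<gamma> x \<in> space M (head Q \<gamma>) \<and>
        (\<forall>y\<in>space M (tail Q \<gamma>). act M \<gamma> (x + y) = act M \<gamma> x + act M \<gamma> y) \<and>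
        (\<forall>c. act M \<gamma> (scl M c x) = scl M c (act M \<gamma> x))) \<and>
     (\<forall>(u, p, v)\<in>\<rho>. \<forall>x\<in>space M u. fold (act M) p x = 0)"

definition zero_rep :: "('v,'q) pre_digraph \<Rightarrow> ('k,'v,'q,'m::ab_group_add) rep \<Rightarrow> bool" where
  "zero_rep Q M \<longleftrightarrow> (\<forall>v\<in>verts Q. space M v = {0})"

definition decomposable ::
    "('v,'q) pre_digraph \<Rightarrow> ('v,'q) qpath set \<Rightarrow> ('k::field,'v,'q,'m::ab_group_add) rep \<Rightarrow> bool" where
  "decomposable Q \<rho> M \<longleftrightarrow>
     (\<exists>U W. bound_rep Q \<rho> (M\<lparr>space := U\<rparr>) \<and> bound_rep Q \<rho> (M\<lparr>space := W\<rparr>) \<and>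
        \<not> zero_rep Q (M\<lparr>space := U\<rparr>) \<and> \<not> zero_rep Q (M\<lparr>space := W\<rparr>) \<and>
        (\<forall>v\<in>verts Q. space M v = {x + y | x y. x \<in> U v \<and> y \<in> W v} \<and> U v \<inter> W v = {0}))"


section \<open>Trees and generalised tree modules\<close>

text \<open>
  \<open>Digraph_Component.tree\<close> only excludes directed cycles. Simple connectedness of the
  underlying undirected multigraph is expressed by doubling: \<open>(e, True)\<close> is the arrow \<open>e\<close>
  and \<open>(e, False)\<close> its reverse. A cycle of the underlying graph is a cycle of the double
  that does not use an arrow twice, which excludes \<open>e\<close> followed by its reverse.
\<close>

definition double_quiver :: "('v,'a) pre_digraph \<Rightarrow> ('v, 'a \<times> bool) pre_digraph" where
  "double_quiver G =
     \<lparr> verts = verts G, arcs = arcs G \<times> UNIV,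
       tail = (\<lambda>(e, d). if d then tail G e else head G e),
       head = (\<lambda>(e, d). if d then head G e else tail G e) \<rparr>"

definition tree_quiver :: "('v,'a) pre_digraph \<Rightarrow> bool" where
  "tree_quiver T \<longleftrightarrow>
     fin_digraph T \<and> Digraph_Component.connected T \<and>
     (\<nexists>p. pre_digraph.cycle (double_quiver T) p \<and> distinct (map fst p))"

definition bound_quiver_morphism ::
    "'k::field itself \<Rightarrow> ('n,'a) pre_digraph \<Rightarrow> ('v,'q) pre_digraph \<Rightarrow> ('v,'q) qpath set \<Rightarrow>
     ('n \<Rightarrow> 'v) \<Rightarrow> ('a \<Rightarrow> 'q) \<Rightarrow> bool" where
  "bound_quiver_morphism K T Q \<rho> F0 F1 \<longleftrightarrow>
     (\<forall>n\<in>verts T. F0 n \<in> verts Q) \<and>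
     (\<forall>a\<in>arcs T. F1 a \<in> arcs Q \<and> tail Q (F1 a) = F0 (tail T a) \<and> head Q (F1 a) = F0 (head T a)) \<and>
     (\<forall>(u, p, v)\<in>qpaths T. \<not> in_relation_ideal K Q \<rho> (F0 u, map F1 p, F0 v))"

text \<open>The basis vector \<open>v\<^sub>n\<close> is \<open>Poly_Mapping.single n 1\<close>.\<close>

definition tree_module ::
    "(nat,'a) pre_digraph \<Rightarrow> (nat \<Rightarrow> 'v) \<Rightarrow> ('a \<Rightarrow> 'q) \<Rightarrow> ('k::field,'v,'q, nat \<Rightarrow>\<^sub>0 'k) rep" where
  "tree_module T F0 F1 =
     \<lparr> scl = (\<lambda>c. Poly_Mapping.map ((*) c)),
       space = (\<lambda>v. {x. Poly_Mapping.keys x \<subseteq> {n \<in> verts T. F0 n = v}}),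
       act = (\<lambda>\<gamma> x. \<Sum>n\<in>verts T. Poly_Mapping.map ((*) (Poly_Mapping.lookup x n))
                (\<Sum>a\<in>{a \<in> arcs T. tail T a = n \<and> F1 a = \<gamma>}. Poly_Mapping.single (head T a) 1)) \<rparr>"

lemma lookup_map_scale:
  "Poly_Mapping.lookup (Poly_Mapping.map ((*) c) x) m = c * Poly_Mapping.lookup x m"
  for c :: "'k::field"
  by (simp add: Poly_Mapping.map.rep_eq when_def)

lemma lookup_tree_act:
  assumes "fin_digraph T"
  shows "Poly_Mapping.lookup (act (tree_module T F0 F1) \<gamma> x) m =
    (\<Sum>a\<in>{a \<in> arcs T. F1 a = \<gamma> \<and> head T a = m}. Poly_Mapping.lookup x (tail T a))"
proof -
  interpret fin_digraph T by fact
  let ?A = "{a \<in> arcs T. F1 a = \<gamma>}"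
  let ?f = "\<lambda>a. Poly_Mapping.lookup x (tail T a) * (if head T a = m then 1 else 0)"
  have "Poly_Mapping.lookup (act (tree_module T F0 F1) \<gamma> x) m =
      (\<Sum>n\<in>verts T. \<Sum>a\<in>{a \<in> ?A. tail T a = n}. ?f a)"
    by (auto simp: tree_module_def lookup_sum lookup_map_scale sum_distrib_left lookup_single
        when_def intro!: sum.cong)
  also have "\<dots> = sum ?f ?A"
    by (rule sum.group) auto
  also have "\<dots> = (\<Sum>a\<in>?A. if head T a = m then Poly_Mapping.lookup x (tail T a) else 0)"
    by (intro sum.cong) auto
  also have "\<dots> = (\<Sum>a\<in>{a \<in> ?A. head T a = m}. Poly_Mapping.lookup x (tail T a))"
    by (rule sum.inter_filter[symmetric]) auto
  finally show ?thesis by (simp add: conj_assoc)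
qed

lemma lookup_fold_tree_act:
  assumes "fin_digraph T"
    and "Poly_Mapping.lookup (fold (act (tree_module T F0 F1)) p x) m \<noteq> 0"
    and "Poly_Mapping.keys x \<subseteq> verts T"
  shows "\<exists>n q. pre_digraph.awalk T n q m \<and> map F1 q = p \<and> Poly_Mapping.lookup x n \<noteq> 0"
  using assms(2,3)
proof (induction p arbitrary: x)
  case Nil
  then have "pre_digraph.awalk T m [] m"
    by (auto simp: pre_digraph.awalk_def pre_digraph.cas.simps in_keys_iff)
  with Nil show ?case by fastforce
next
  case (Cons \<gamma> p)
  interpret fin_digraph T by fact
  let ?y = "act (tree_module T F0 F1) \<gamma> x"
  have supp: "\<exists>a\<in>arcs T. F1 a = \<gamma> \<and> head T a = n \<and> Poly_Mapping.lookup x (tail T a) \<noteq> 0"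
    if "Poly_Mapping.lookup ?y n \<noteq> 0" for n
    using that by (force simp: lookup_tree_act[OF assms(1)] dest: sum.not_neutral_contains_not_neutral)
  then have "Poly_Mapping.keys ?y \<subseteq> verts T"
    by (metis head_in_verts in_keys_iff subsetI)
  then obtain n q where q: "awalk n q m" "map F1 q = p" "Poly_Mapping.lookup ?y n \<noteq> 0"
    using Cons.IH[of ?y] Cons.prems by auto
  from supp[OF q(3)] obtain a where
    "a \<in> arcs T" "F1 a = \<gamma>" "head T a = n" "Poly_Mapping.lookup x (tail T a) \<noteq> 0"
    by auto
  with q show ?case
    by (intro exI[of _ "tail T a"] exI[of _ "a # q"]) (auto simp: awalk_Cons_iff)
qed

lemma morphism_cas:
  assumes "bound_quiver_morphism K T Q \<rho> F0 F1" "set q \<subseteq> arcs T" "pre_digraph.cas T n q m"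
    and "pre_digraph.cas Q u (map F1 q) v" "F0 n = u"
  shows "F0 m = v"
  using assms(2-5)
  by (induction q arbitrary: n u)
    (use assms(1) in \<open>auto simp: pre_digraph.cas.simps bound_quiver_morphism_def\<close>)

text \<open>Sanity check: \<open>F\<^sub>\<lambda>(V\<^sub>T)\<close> is indeed a bound representation of \<open>(Q, \<rho>)\<close>.\<close>

lemma bound_rep_tree_module:
  fixes T :: "(nat,'a) pre_digraph"
  assumes "zero_relation_quiver TYPE('k::field) Q \<rho>" "fin_digraph T"
    and "bound_quiver_morphism TYPE('k) T Q \<rho> F0 F1"
  shows "bound_rep Q \<rho> (tree_module T F0 F1 :: ('k,'v,'q, nat \<Rightarrow>\<^sub>0 'k) rep)"
proof -
  let ?M = "tree_module T F0 F1 :: ('k,'v,'q, nat \<Rightarrow>\<^sub>0 'k) rep"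
  have scl: "scl ?M = (\<lambda>c. Poly_Mapping.map ((*) c))"
    and space: "space ?M v = {x. Poly_Mapping.keys x \<subseteq> {n \<in> verts T. F0 n = v}}" for v
    by (simp_all add: tree_module_def)
  note act = lookup_tree_act[OF assms(2)]
  have vs: "vector_space (scl ?M)"
    unfolding scl
    by unfold_locales
      (auto intro!: poly_mapping_eqI simp: lookup_map_scale lookup_add algebra_simps)
  then have mod: "module (scl ?M)"
    by (simp add: module_iff_vector_space)
  have zero: "fold (act ?M) p x = 0" if rel: "(u, p, v) \<in> \<rho>" and x: "x \<in> space ?M u" for u p v x
  proof (rule ccontr)
    assume "fold (act ?M) p x \<noteq> 0"
    then obtain m where "Poly_Mapping.lookup (fold (act ?M) p x) m \<noteq> 0"
      by (metis lookup_zero poly_mapping_eqI)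
    then obtain n q where q: "pre_digraph.awalk T n q m" "map F1 q = p" "Poly_Mapping.lookup x n \<noteq> 0"
      using lookup_fold_tree_act[OF assms(2)] x space by blast
    have n: "F0 n = u"
      using q(3) x by (auto simp: space in_keys_iff)
    have "pre_digraph.awalk Q u p v"
      using rel assms(1) by (auto simp: zero_relation_quiver_def qpaths_def)
    then have "F0 m = v"
      using morphism_cas[OF assms(3), of q n m u v] q n by (auto simp: pre_digraph.awalk_def)
    then have "\<not> in_relation_ideal TYPE('k) Q \<rho> (u, p, v)"
      using assms(3) q n unfolding bound_quiver_morphism_def qpaths_def by blast
    then show False
      using rel by (auto simp: in_relation_ideal_def relation_ideal_def)
  qed
  have closed: "act ?M \<gamma> x \<in> space ?M (head Q \<gamma>)" if "x \<in> space ?M (tail Q \<gamma>)" for \<gamma> x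
  proof -
    have "m \<in> verts T \<and> F0 m = head Q \<gamma>" if nz: "Poly_Mapping.lookup (act ?M \<gamma> x) m \<noteq> 0" for m
    proof -
      obtain a where "a \<in> arcs T" "F1 a = \<gamma>" "head T a = m"
        using nz unfolding act by (rule sum.not_neutral_contains_not_neutral) blast
      then show ?thesis
        using assms(2,3) by (auto simp: bound_quiver_morphism_def fin_digraph_def wf_digraph_def)
    qed
    then show ?thesis by (auto simp: space in_keys_iff)
  qed
  have sub: "module.subspace (scl ?M) (space ?M v)" for v
    unfolding module.subspace_def[OF mod]
    by (auto simp: space scl in_keys_iff subset_iff lookup_add lookup_map_scale)
       (metis add.right_neutral lookup_zero)+
  show ?thesis
    unfolding bound_rep_def
    using vs sub closed zero
    by (auto intro!: poly_mapping_eqI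
        simp: act lookup_add sum.distrib scl lookup_map_scale sum_distrib_left)
qed


section \<open>Networks\<close>

record ('x,'a) network =
  quiver :: "('x,'a) pre_digraph"
  edges :: "'x set set"

abbreviation net_verts :: "('x,'a) network \<Rightarrow> 'x set" where
  "net_verts N \<equiv> verts (quiver N)"

abbreviation net_arcs :: "('x,'a) network \<Rightarrow> 'a set" where
  "net_arcs N \<equiv> arcs (quiver N)"

definition subnetwork :: "('x,'a) network \<Rightarrow> ('x,'a) network \<Rightarrow> bool" where
  "subnetwork M N \<longleftrightarrow>
     subgraph (quiver M) (quiver N) \<and> edges M \<subseteq> edges N \<and> (\<forall>e\<in>edges M. e \<subseteq> net_verts M)"

definition link :: "('x,'a) network \<Rightarrow> 'x \<Rightarrow> 'x \<Rightarrow> bool" where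
  "link N x y \<longleftrightarrow>
     (\<exists>e\<in>net_arcs N. (tail (quiver N) e = x \<and> head (quiver N) e = y) \<or>
                        (tail (quiver N) e = y \<and> head (quiver N) e = x)) \<or>
     {x, y} \<in> edges N"

definition connected_network :: "('x,'a) network \<Rightarrow> bool" where
  "connected_network N \<longleftrightarrow> (\<forall>x\<in>net_verts N. \<forall>y\<in>net_verts N. (link N)\<^sup>*\<^sup>* x y)"


section \<open>The pullback network and its 2-covering network\<close>

definition pullback_verts :: "(nat,'a) pre_digraph \<Rightarrow> (nat \<Rightarrow> 'v) \<Rightarrow> (nat \<times> nat) set" where
  "pullback_verts T F0 = {(n, m). n \<in> verts T \<and> m \<in> verts T \<and> F0 n = F0 m}"

definition pullback_network ::
    "(nat,'a) pre_digraph \<Rightarrow> (nat \<Rightarrow> 'v) \<Rightarrow> ('a \<Rightarrow> 'q) \<Rightarrow> (nat \<times> nat, 'a \<times> 'a) network" where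
  "pullback_network T F0 F1 =
     \<lparr> quiver =
         \<lparr> verts = pullback_verts T F0,
           arcs = {(a, b). a \<in> arcs T \<and> b \<in> arcs T \<and> F1 a = F1 b},
           tail = (\<lambda>(a, b). (tail T a, tail T b)),
           head = (\<lambda>(a, b). (head T a, head T b)) \<rparr>,
       edges =
         {{(n, m), (n', m)} | n n' m.
            (n, m) \<in> pullback_verts T F0 \<and> (n', m) \<in> pullback_verts T F0 \<and> n \<noteq> n' \<and>
            (\<exists>a\<in>arcs T. \<exists>b\<in>arcs T. tail T a = tail T b \<and> head T a = n \<and> head T b = n' \<and> F1 a = F1 b)}
         \<union>
         {{(n, m), (n, m')} | n m m'.
            (n, m) \<in> pullback_verts T F0 \<and> (n, m') \<in> pullback_verts T F0 \<and> m \<noteq> m' \<and>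
            (\<exists>c\<in>arcs T. \<exists>d\<in>arcs T. head T c = head T d \<and> tail T c = m \<and> tail T d = m' \<and> F1 c = F1 d)} \<rparr>"

definition covering_network ::
    "(nat,'a) pre_digraph \<Rightarrow> (nat \<Rightarrow> 'v) \<Rightarrow> ('a \<Rightarrow> 'q) \<Rightarrow> (nat \<times> nat \<times> int, 'a \<times> 'a \<times> int) network" where
  "covering_network T F0 F1 =
     \<lparr> quiver =
         \<lparr> verts = {(n, m, j). (n, m) \<in> net_verts (pullback_network T F0 F1) \<and> j \<in> {-1, 1}},
           arcs = {(a, b, j). (a, b) \<in> net_arcs (pullback_network T F0 F1) \<and> j \<in> {-1, 1}},
           tail = (\<lambda>(a, b, j). (tail T a, tail T b, j)),
           head = (\<lambda>(a, b, j). (head T a, head T b, j)) \<rparr>,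
       edges =
         {{(n, m, j), (n', m', -j)} | n m n' m' j.
            {(n, m), (n', m')} \<in> edges (pullback_network T F0 F1) \<and> j \<in> {-1, 1}} \<rparr>"

definition forget_sign :: "nat \<times> nat \<times> int \<Rightarrow> nat \<times> nat" where
  "forget_sign = (\<lambda>(n, m, j). (n, m))"


section \<open>Generalised graph maps\<close>

definition complete_network ::
    "(nat,'a) pre_digraph \<Rightarrow> ('a \<Rightarrow> 'q) \<Rightarrow> (nat \<times> nat \<times> int, 'a \<times> 'a \<times> int) network \<Rightarrow> bool" where
  "complete_network T F1 M \<longleftrightarrow> (\<forall>(n, m, j)\<in>net_verts M.
     (\<forall>a\<in>arcs T. head T a = n \<longrightarrow>
        (\<exists>b\<in>arcs T. head T b = m \<and> (a, b, j) \<in> net_arcs M) \<or>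
        (\<exists>c\<in>arcs T. tail T c = tail T a \<and> F1 a = F1 c \<and> (head T c, m, -j) \<in> net_verts M \<and>
           {(n, m, j), (head T c, m, -j)} \<in> edges M)) \<and>
     (\<forall>b\<in>arcs T. tail T b = m \<longrightarrow>
        (\<exists>a\<in>arcs T. tail T a = n \<and> (a, b, j) \<in> net_arcs M) \<or>
        (\<exists>d\<in>arcs T. head T d = head T b \<and> F1 b = F1 d \<and> (n, tail T d, -j) \<in> net_verts M \<and>
           {(n, m, j), (n, tail T d, -j)} \<in> edges M)))"

definition R2_free ::
    "(nat,'a) pre_digraph \<Rightarrow> (nat \<Rightarrow> 'v) \<Rightarrow> ('a \<Rightarrow> 'q) \<Rightarrow>
     (nat \<times> nat \<times> int, 'a \<times> 'a \<times> int) network \<Rightarrow> bool" where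
  "R2_free T F0 F1 M \<longleftrightarrow>
     \<not> (\<exists>x\<in>net_verts M. \<exists>y\<in>net_verts M. \<exists>z\<in>net_verts M.
          link M x y \<and> link M y z \<and>
          distinct [forget_sign x, forget_sign y, forget_sign z] \<and>
          link (pullback_network T F0 F1) (forget_sign x) (forget_sign y) \<and>
          link (pullback_network T F0 F1) (forget_sign y) (forget_sign z) \<and>
          link (pullback_network T F0 F1) (forget_sign x) (forget_sign z))"

definition involution_free :: "(nat \<times> nat \<times> int, 'a \<times> 'a \<times> int) network \<Rightarrow> bool" where
  "involution_free M \<longleftrightarrow> (\<forall>(n, m, j)\<in>net_verts M. (n, m, -j) \<notin> net_verts M)"

definition generalised_graph_map ::
    "(nat,'a) pre_digraph \<Rightarrow> (nat \<Rightarrow> 'v) \<Rightarrow> ('a \<Rightarrow> 'q) \<Rightarrow>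
     (nat \<times> nat \<times> int, 'a \<times> 'a \<times> int) network \<Rightarrow> bool" where
  "generalised_graph_map T F0 F1 G \<longleftrightarrow>
     subnetwork G (covering_network T F0 F1) \<and> net_verts G \<noteq> {} \<and> connected_network G \<and>
     involution_free G \<and> complete_network T F1 G \<and> R2_free T F0 F1 G"


section \<open>The shape of the trees\<close>

text \<open>
  \<open>T\<close> consists of disjoint subtrees \<open>S 0, \<dots>, S k\<close> with \<open>j\<close> a vertex of \<open>S j\<close>, and connecting
  arrows \<open>a 1, \<dots>, a k\<close>, where \<open>a j\<close> goes from \<open>src j\<close> to \<open>tgt j\<close>.
\<close>

definition tree_shape ::
    "(nat,'a) pre_digraph \<Rightarrow> nat \<Rightarrow> (nat \<Rightarrow> (nat,'a) pre_digraph) \<Rightarrow> (nat \<Rightarrow> 'a) \<Rightarrow>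
     (nat \<Rightarrow> nat) \<Rightarrow> (nat \<Rightarrow> nat) \<Rightarrow> bool" where
  "tree_shape T k S a src tgt \<longleftrightarrow>
     tree_quiver T \<and>
     (\<forall>i\<in>{0..k}. subgraph (S i) T \<and> tree_quiver (S i) \<and> i \<in> verts (S i)) \<and>
     (\<forall>i\<in>{0..k}. \<forall>j\<in>{0..k}. i \<noteq> j \<longrightarrow> verts (S i) \<inter> verts (S j) = {}) \<and>
     verts T = (\<Union>i\<in>{0..k}. verts (S i)) \<and>
     arcs T = (\<Union>i\<in>{0..k}. arcs (S i)) \<union> a ` {1..k} \<and>
     (\<forall>j\<in>{1..k}. tail T (a j) = src j \<and> head T (a j) = tgt j)"

text \<open>\<open>T \<restriction> (verts (S j) \<union> {0})\<close> is the subtree induced by the vertices of \<open>S j\<close> and \<open>0\<close>.\<close>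

definition branches_unramified ::
    "(nat,'a) pre_digraph \<Rightarrow> nat \<Rightarrow> (nat \<Rightarrow> (nat,'a) pre_digraph) \<Rightarrow> ('a \<Rightarrow> 'q) \<Rightarrow> bool" where
  "branches_unramified T k S F1 \<longleftrightarrow>
     (\<forall>j\<in>{1..k}. \<forall>c\<in>arcs (T \<restriction> (verts (S j) \<union> {0})). \<forall>d\<in>arcs (T \<restriction> (verts (S j) \<union> {0})).
        c \<noteq> d \<and> (tail T c = tail T d \<or> head T c = head T d) \<longrightarrow> F1 c \<noteq> F1 d)"

end

theory Submission
  imports Defs
begin

text \<open>
  Let \<open>C\<close> be the connected component of \<open>(n\<^sub>1, n\<^sub>2)\<close> in the pullback of the branches at \<open>n\<^sub>1\<close>
  and \<open>n\<^sub>2\<close>. Both branches are unramified, so completeness of \<open>G\<close> can never be met by an edge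
  over their product and forces \<open>G\<close> to contain \<open>C\<close> with a constant sign. Along \<open>C\<close>, reduced walks
  in one branch correspond to reduced walks in the other; since closed reduced walks in trees are
  trivial, \<open>(n\<^sub>1, n\<^sub>2)\<close> is the only pair in \<open>C\<close> that involves \<open>n\<^sub>1\<close> or \<open>n\<^sub>2\<close>. Completeness then makes
  \<open>v\<^sub>n \<mapsto> \<Sum> {v\<^sub>m | (n, m) \<in> C}\<close> a homomorphism \<open>h\<close> between the modules of the two branches that
  sends the first root to the second. If the connecting arrows leave \<open>0\<close>, replacing the first branch
  by the elements \<open>x + h x\<close> splits off the second; if they enter \<open>0\<close>, the elements \<open>x - h x\<close> form
  a direct summand.
\<close>

section \<open>Walks in pullbacks of trees\<close>

text \<open>Only an arrow followed by its own reverse is forbidden, as for reduced words in the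
  fundamental groupoid of the underlying graph.\<close>

definition reduced_walk :: "('a \<times> bool) list \<Rightarrow> bool" where
  "reduced_walk = successively (\<lambda>x y. fst x = fst y \<longrightarrow> snd x = snd y)"

lemma wf_digraph_double_quiver: "wf_digraph G \<Longrightarrow> wf_digraph (double_quiver G)"
  by (auto simp: wf_digraph_def double_quiver_def)

text \<open>Suppose that two letters use the same arrow. With equal directions they have the same
  head, against distinctness. With opposite directions the later one starts where the earlier one
  ends, so distinctness makes them adjacent, which is the backtracking that
  \<open>reduced_walk\<close> excludes.\<close>

lemma reduced_cycle_distinct:
  assumes "wf_digraph G" "pre_digraph.awalk (double_quiver G) u p u" "reduced_walk p"
    and "distinct (tl (pre_digraph.awalk_verts (double_quiver G) u p))"
  shows "distinct (map fst p)"
proof -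
  interpret D: wf_digraph "double_quiver G"
    using assms(1) by (rule wf_digraph_double_quiver)
  have cas: "D.cas u p u" using assms(2) by (simp add: D.awalk_def)
  have dist: "distinct (map (head (double_quiver G)) p)"
    using assms(4) unfolding D.awalk_verts_conv'[OF cas] by (auto split: if_splits)
  have step: "tail (double_quiver G) (p ! Suc i) = head (double_quiver G) (p ! i)"
    if "Suc i < length p" "D.cas u p v" for i u v
    using that
  proof (induction p arbitrary: u i)
    case (Cons x p)
    show ?case
    proof (cases i)
      case 0
      with Cons.prems show ?thesis by (cases p) auto
    next
      case (Suc l)
      with Cons show ?thesis by auto
    qed
  qed simp
  have aux: "fst (p ! i) \<noteq> fst (p ! j)" if ij: "i < j" "j < length p" for i j
  proof
    assume eq: "fst (p ! i) = fst (p ! j)"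
    have hd: "head (double_quiver G) (p ! i) \<noteq> head (double_quiver G) (p ! j)"
      using dist ij by (auto simp: distinct_conv_nth)
    have ne: "snd (p ! i) \<noteq> snd (p ! j)"
    proof
      assume "snd (p ! i) = snd (p ! j)"
      with eq have "p ! i = p ! j" by (rule prod_eqI)
      with hd show False by simp
    qed
    have "head (double_quiver G) (p ! i) = tail (double_quiver G) (p ! j)"
      using eq ne by (cases "p ! i"; cases "p ! j") (auto simp: double_quiver_def)
    moreover obtain l where l: "j = Suc l" using ij by (cases j) auto
    ultimately have "head (double_quiver G) (p ! i) = head (double_quiver G) (p ! l)"
      using step[of l] ij cas by simp
    then have "i = l"
      using dist ij l by (simp add: distinct_conv_nth) (metis Suc_lessD order_less_trans)
    then show False
      using assms(3) eq ne ij l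
      by (auto simp: reduced_walk_def successively_conv_nth)
  qed
  have "fst (p ! i) \<noteq> fst (p ! j)" if "i < length p" "j < length p" "i \<noteq> j" for i j
    using aux[of i j] aux[of j i] that by (metis linorder_neqE_nat)
  then show ?thesis
    by (auto simp: distinct_conv_nth)
qed

text \<open>Cutting at repeated vertices leads from a non-empty closed reduced walk to a closed
  subwalk without repetition, since contiguous subwalks stay reduced. This would be a cycle of the
  underlying graph, which a tree does not have.\<close>

lemma closed_reduced_walk_Nil:
  assumes "tree_quiver G" "pre_digraph.awalk (double_quiver G) u p u" "reduced_walk p"
  shows "p = []"
proof (rule ccontr)
  have wf: "wf_digraph G"
    using assms(1) by (simp add: tree_quiver_def fin_digraph_def)
  interpret D: wf_digraph "double_quiver G"
    using wf by (rule wf_digraph_double_quiver)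
  assume "p \<noteq> []"
  with assms(2,3) have "\<exists>q. D.cycle q \<and> distinct (map fst q)"
  proof (induction "length p" arbitrary: p u rule: less_induct)
    case less
    show ?case
    proof (cases "distinct (tl (D.awalk_verts u p))")
      case True
      then show ?thesis
        using less.prems reduced_cycle_distinct[OF wf] unfolding D.cycle_def by blast
    next
      case False
      \<comment> \<open>The vertices of \<open>es\<close> are those of \<open>p\<close> after the
        first, so the repetition already occurs along \<open>es\<close>; hence the closed subwalk
        \<open>r\<close> is shorter than \<open>p\<close>.\<close>
      obtain e es where p: "p = e # es" using less.prems by (cases p) auto
      have w: "D.awalk (head (double_quiver G) e) es u" "\<not> distinct (D.awalk_verts (head (double_quiver G) e) es)"
        using less.prems False p by (auto simp: D.awalk_Cons_iff)
      obtain q r s v where d: "es = q @ r @ s" "0 < length r" "D.awalk v r v"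
        using D.awalk_not_distinct_decomp[OF w] by blast
      moreover have "reduced_walk r"
        using less.prems(2) d(1) p
        by (auto simp: reduced_walk_def successively_append_iff successively_Cons)
      ultimately show ?thesis
        using less.hyps[of r v] p by auto
    qed
  qed
  with assms(1) show False
    by (auto simp: tree_quiver_def)
qed

section \<open>Components in pullbacks of labelled trees\<close>

text \<open>This is the vertex set of one connected component of the fibre product of
  \<open>G\<close> and \<open>H\<close> over \<open>F\<close>; \<open>backward\<close> allows arrows
  to be traversed in reverse.\<close>

inductive pullback_component ::
    "('n,'a) pre_digraph \<Rightarrow> ('n,'a) pre_digraph \<Rightarrow> ('a \<Rightarrow> 'q) \<Rightarrow> 'n \<Rightarrow> 'n \<Rightarrow> 'n \<Rightarrow> 'n \<Rightarrow> bool"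
  for G H F x y where
  base: "pullback_component G H F x y x y"
| forward: "pullback_component G H F x y (tail G a) (tail H b) \<Longrightarrow> a \<in> arcs G \<Longrightarrow> b \<in> arcs H \<Longrightarrow>
    F a = F b \<Longrightarrow> pullback_component G H F x y (head G a) (head H b)"
| backward: "pullback_component G H F x y (head G a) (head H b) \<Longrightarrow> a \<in> arcs G \<Longrightarrow> b \<in> arcs H \<Longrightarrow>
    F a = F b \<Longrightarrow> pullback_component G H F x y (tail G a) (tail H b)"

text \<open>This is the immersion condition for labelled graphs: a walk with prescribed labels and
  directions has at most one lift from a given vertex.\<close>

definition unramified :: "('n,'a) pre_digraph \<Rightarrow> ('a \<Rightarrow> 'q) \<Rightarrow> bool" where
  "unramified G F \<longleftrightarrow> (\<forall>c\<in>arcs G. \<forall>d\<in>arcs G.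
     F c = F d \<and> (tail G c = tail G d \<or> head G c = head G d) \<longrightarrow> c = d)"

definition parallel_walks ::
    "('n,'a) pre_digraph \<Rightarrow> ('n,'a) pre_digraph \<Rightarrow> ('a \<Rightarrow> 'q) \<Rightarrow> 'n \<Rightarrow> 'n \<Rightarrow>
     ('a \<times> bool) list \<Rightarrow> ('a \<times> bool) list \<Rightarrow> 'n \<Rightarrow> 'n \<Rightarrow> bool" where
  "parallel_walks G H F x y p q n m \<longleftrightarrow>
     pre_digraph.awalk (double_quiver G) x p n \<and> pre_digraph.awalk (double_quiver H) y q m \<and>
     reduced_walk p \<and> reduced_walk q \<and> list_all2 (\<lambda>u v. F (fst u) = F (fst v) \<and> snd u = snd v) p q"

text \<open>If neither new letter backtracks, both are appended. If one does, unramifiedness makes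
  the other backtrack too, and both last letters are cancelled. The flag \<open>d\<close> covers
  both directions of traversal.\<close>

lemma parallel_walks_extend:
  assumes "wf_digraph G" "wf_digraph H" "unramified G F" "unramified H F"
    and w: "parallel_walks G H F x y p q n m"
    and a: "a \<in> arcs G" and b: "b \<in> arcs H" and F: "F a = F b"
    and n: "n = tail (double_quiver G) (a, d)" and m: "m = tail (double_quiver H) (b, d)"
  shows "\<exists>p q. parallel_walks G H F x y p q (head (double_quiver G) (a, d)) (head (double_quiver H) (b, d))"
proof -
  interpret D: wf_digraph "double_quiver G"
    using assms(1) by (rule wf_digraph_double_quiver)
  interpret E: wf_digraph "double_quiver H"
    using assms(2) by (rule wf_digraph_double_quiver)
  show ?thesis
  proof (cases "reduced_walk (p @ [(a, d)]) \<and> reduced_walk (q @ [(b, d)])")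
    case True
    have "D.awalk n [(a, d)] (head (double_quiver G) (a, d))"
        "E.awalk m [(b, d)] (head (double_quiver H) (b, d))"
      using a b n m D.arc_implies_awalk[of "(a, d)"] E.arc_implies_awalk[of "(b, d)"]
      by (simp_all add: double_quiver_def)
    then have "parallel_walks G H F x y (p @ [(a, d)]) (q @ [(b, d)])
        (head (double_quiver G) (a, d)) (head (double_quiver H) (b, d))"
      using w True F unfolding parallel_walks_def
      by (intro conjI D.awalk_appendI E.awalk_appendI list_all2_appendI) auto
    then show ?thesis by blast
  next
    case False
    then have ne: "p \<noteq> [] \<and> q \<noteq> []"
      using w by (auto simp: parallel_walks_def reduced_walk_def)
    obtain p' a' d' where p: "p = p' @ [(a', d')]"
      using ne by (cases p rule: rev_cases) auto
    obtain q' b' d'' where q: "q = q' @ [(b', d'')]"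
      using ne by (cases q rule: rev_cases) auto
    have len: "length p' = length q'"
      using w p q by (auto simp: parallel_walks_def dest: list_all2_lengthD)
    have l2: "list_all2 (\<lambda>u v. F (fst u) = F (fst v) \<and> snd u = snd v) p' q'" "F a' = F b'" "d'' = d'"
      using w p q len by (auto simp: parallel_walks_def list_all2_append)
    have red: "reduced_walk p'" "reduced_walk q'" "reduced_walk p" "reduced_walk q"
      using w p q by (auto simp: parallel_walks_def reduced_walk_def successively_append_iff)
    have aw: "D.awalk x p' (tail (double_quiver G) (a', d'))" "(a', d') \<in> arcs (double_quiver G)"
        "n = head (double_quiver G) (a', d')"
      using w p by (auto simp: parallel_walks_def D.awalk_simps)
    have bw: "E.awalk y q' (tail (double_quiver H) (b', d'))" "(b', d') \<in> arcs (double_quiver H)"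
        "m = head (double_quiver H) (b', d')"
      using w q l2 by (auto simp: parallel_walks_def E.awalk_simps)
    from False have "(a = a' \<or> b = b') \<and> d \<noteq> d'"
      using red p q l2 by (auto simp: reduced_walk_def successively_append_iff)
    then have dd: "d' = (\<not> d)" and "a = a' \<or> b = b'" by auto
    \<comment> \<open>Cancellation passes to the other factor: there the last arrow and the new
      arrow have equal labels and, depending on \<open>d\<close>, a common tail or a common
      head.\<close>
    then have "a = a' \<and> b = b'"
      using F l2 a b aw bw n m assms(3,4) unfolding unramified_def
      by (auto simp: double_quiver_def split: if_splits)
    then have "parallel_walks G H F x y p' q'
        (head (double_quiver G) (a, d)) (head (double_quiver H) (b, d))"
      using aw bw red l2 dd by (auto simp: parallel_walks_def double_quiver_def)
    then show ?thesis by blast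
  qed
qed

lemma pullback_component_parallel_walks:
  assumes "wf_digraph G" "wf_digraph H" "unramified G F" "unramified H F"
    and "x \<in> verts G" "y \<in> verts H" "pullback_component G H F x y n m"
  shows "\<exists>p q. parallel_walks G H F x y p q n m"
  using assms(7)
proof induction
  case base
  then show ?case
    using assms(5,6)
    by (intro exI[of _ "[]"]) (auto simp: parallel_walks_def reduced_walk_def
      pre_digraph.awalk_def pre_digraph.cas.simps double_quiver_def)
next
  case (forward a b)
  then show ?case
    using parallel_walks_extend[OF assms(1-4), where d = True] by (fastforce simp: double_quiver_def)
next
  case (backward a b)
  then show ?case
    using parallel_walks_extend[OF assms(1-4), where d = False] by (fastforce simp: double_quiver_def)
qed

text \<open>Parallel walks have equal length, so one is trivial exactly when the other is. By
  \<open>closed_reduced_walk_Nil\<close>, a reduced walk in a tree ends where it starts only if it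
  is trivial.\<close>

lemma pullback_component_injective_at_root:
  assumes "tree_quiver G" "tree_quiver H" "unramified G F" "unramified H F"
    and "x \<in> verts G" "y \<in> verts H" "pullback_component G H F x y n m"
  shows "n = x \<longleftrightarrow> m = y"
proof -
  have wf: "wf_digraph G" "wf_digraph H"
    using assms(1,2) by (auto simp: tree_quiver_def fin_digraph_def)
  obtain p q where w: "parallel_walks G H F x y p q n m"
    using pullback_component_parallel_walks[OF wf assms(3-7)] by blast
  have "p = [] \<longleftrightarrow> q = []"
    using w by (auto simp: parallel_walks_def)
  moreover have "n = x \<longleftrightarrow> p = []"
    using w closed_reduced_walk_Nil[OF assms(1), of x p]
    by (auto simp: parallel_walks_def pre_digraph.awalk_def pre_digraph.cas.simps)
  moreover have "m = y \<longleftrightarrow> q = []"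
    using w closed_reduced_walk_Nil[OF assms(2), of y q]
    by (auto simp: parallel_walks_def pre_digraph.awalk_def pre_digraph.cas.simps)
  ultimately show ?thesis by simp
qed

lemma pullback_component_subset:
  assumes "wf_digraph G" "wf_digraph H" "x \<in> verts G" "y \<in> verts H"
    and "pullback_component G H F x y n m"
  shows "n \<in> verts G \<and> m \<in> verts H"
  using assms(5,3,4) by induction (use assms(1,2) in \<open>auto simp: wf_digraph_def\<close>)

section \<open>Idempotent endomorphisms of tree modules\<close>

text \<open>The summands are the fixed vectors of \<open>e\<close> and its kernel, by
  \<open>x = e x + (x - e x)\<close>; \<open>nonzero\<close> and \<open>nonid\<close> ensure that
  neither vanishes.\<close>

lemma decomposable_if_idempotent_endomorphism:
  fixes M :: "('k::field,'v,'q,'m::ab_group_add) rep"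
  assumes M: "bound_rep Q \<rho> M"
    and wf: "wf_digraph Q" "\<rho> \<subseteq> qpaths Q"
    and add: "\<And>x y. e (x + y) = e x + e y"
    and scale: "\<And>c x. e (scl M c x) = scl M c (e x)"
    and closed: "\<And>v x. v \<in> verts Q \<Longrightarrow> x \<in> space M v \<Longrightarrow> e x \<in> space M v"
    and commute: "\<And>\<gamma> x. \<gamma> \<in> arcs Q \<Longrightarrow> x \<in> space M (tail Q \<gamma>) \<Longrightarrow> e (act M \<gamma> x) = act M \<gamma> (e x)"
    and idem: "\<And>v x. v \<in> verts Q \<Longrightarrow> x \<in> space M v \<Longrightarrow> e (e x) = e x"
    and nonzero: "v \<in> verts Q" "x \<in> space M v" "e x \<noteq> 0"
    and nonid: "w \<in> verts Q" "y \<in> space M w" "e y \<noteq> y"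
  shows "decomposable Q \<rho> M"
proof -
  define U where "U v = {x \<in> space M v. e x = x}" for v
  define W where "W v = {x \<in> space M v. e x = 0}" for v
  interpret vector_space "scl M"
    using M by (simp add: bound_rep_def)
  have sub: "subspace (space M v)" if "v \<in> verts Q" for v
    using M that by (simp add: bound_rep_def)
  have e0: "e 0 = 0"
    using scale[of 0 0] by simp
  have e_diff: "e (x - y) = e x - e y" for x y
    using add[of "x - y" y] by (simp add: algebra_simps)
  have subU: "subspace (U v)" and subW: "subspace (W v)" if "v \<in> verts Q" for v
    using sub[OF that] e0 by (auto simp: subspace_def U_def W_def add scale)
  \<comment> \<open>In \<open>bound_rep\<close> an arrow is linear only on the space at its tail, so
    this comes from homogeneity at the zero vector of that space.\<close>
  have act0: "act M \<gamma> 0 = 0" if "\<gamma> \<in> arcs Q" for \<gamma>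
  proof -
    have "tail Q \<gamma> \<in> verts Q" using wf that by (simp add: wf_digraph.tail_in_verts)
    then have "0 \<in> space M (tail Q \<gamma>)" using sub by (simp add: subspace_def)
    then have "act M \<gamma> (scl M 0 0) = scl M 0 (act M \<gamma> 0)"
      using M that unfolding bound_rep_def by blast
    then show ?thesis by simp
  qed
  have rep: "bound_rep Q \<rho> (M\<lparr>space := Z\<rparr>)"
    if "\<And>v. v \<in> verts Q \<Longrightarrow> subspace (Z v)" "\<And>v. Z v \<subseteq> space M v"
      and "\<And>\<gamma> x. \<gamma> \<in> arcs Q \<Longrightarrow> x \<in> Z (tail Q \<gamma>) \<Longrightarrow> act M \<gamma> x \<in> Z (head Q \<gamma>)" for Z
    using M that unfolding bound_rep_def by (fastforce simp: subset_iff)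
  have repU: "bound_rep Q \<rho> (M\<lparr>space := U\<rparr>)"
  proof (rule rep)
    fix \<gamma> x assume "\<gamma> \<in> arcs Q" "x \<in> U (tail Q \<gamma>)"
    then show "act M \<gamma> x \<in> U (head Q \<gamma>)"
      using M commute[of \<gamma> x] by (auto simp: U_def bound_rep_def)
  qed (rule subU, assumption, auto simp: U_def)
  have repW: "bound_rep Q \<rho> (M\<lparr>space := W\<rparr>)"
  proof (rule rep)
    fix \<gamma> x assume "\<gamma> \<in> arcs Q" "x \<in> W (tail Q \<gamma>)"
    then show "act M \<gamma> x \<in> W (head Q \<gamma>)"
      using M commute[of \<gamma> x] act0 by (auto simp: W_def bound_rep_def)
  qed (rule subW, assumption, auto simp: W_def)
  have "e x \<in> U v"
    using nonzero closed idem by (auto simp: U_def)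
  then have nzU: "\<not> zero_rep Q (M\<lparr>space := U\<rparr>)"
    using nonzero by (auto simp: zero_rep_def)
  have inW: "y - e y \<in> W w" if "w \<in> verts Q" "y \<in> space M w" for y w
    using that closed[OF that] idem[OF that] subspace_diff[OF sub] by (auto simp: W_def e_diff)
  have "y - e y \<noteq> 0" using nonid by simp
  then have nzW: "\<not> zero_rep Q (M\<lparr>space := W\<rparr>)"
    using nonid(1) inW[OF nonid(1,2)] by (auto simp: zero_rep_def intro!: bexI[of _ w])
  have "space M v = {x + y | x y. x \<in> U v \<and> y \<in> W v}" if v: "v \<in> verts Q" for v
  proof (intro equalityI subsetI)
    fix x assume x: "x \<in> space M v"
    then have "e x \<in> U v" using v closed idem by (auto simp: U_def)
    moreover have "x - e x \<in> W v" using v x by (rule inW)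
    moreover have "x = e x + (x - e x)" by simp
    ultimately show "x \<in> {x + y | x y. x \<in> U v \<and> y \<in> W v}" by blast
  next
    fix x assume "x \<in> {x + y | x y. x \<in> U v \<and> y \<in> W v}"
    then show "x \<in> space M v"
      using subspace_add[OF sub[OF v]] by (auto simp: U_def W_def)
  qed
  moreover have "U v \<inter> W v = {0}" if "v \<in> verts Q" for v
    using sub[OF that] e0 by (auto simp: U_def W_def subspace_def)
  ultimately show ?thesis
    unfolding decomposable_def using repU repW nzU nzW by blast
qed

text \<open>Entry \<open>E n m\<close> is the coefficient of \<open>v\<^sub>m\<close> in the image of \<open>v\<^sub>n\<close>.\<close>

definition idempotent_matrix ::
    "'n set \<Rightarrow> 'a set \<Rightarrow> ('a \<Rightarrow> 'n) \<Rightarrow> ('a \<Rightarrow> 'n) \<Rightarrow> ('n \<Rightarrow> 'v) \<Rightarrow> ('a \<Rightarrow> 'q) \<Rightarrow>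
     ('n \<Rightarrow> 'n \<Rightarrow> 'k::field) \<Rightarrow> bool" where
  "idempotent_matrix V A t h F0 F1 E \<longleftrightarrow>
     (\<forall>n m. E n m \<noteq> 0 \<longrightarrow> n \<in> V \<and> m \<in> V \<and> F0 n = F0 m) \<and>
     (\<forall>n m. (\<Sum>p\<in>V. E n p * E p m) = E n m) \<and>
     (\<forall>\<gamma> n m. (\<Sum>a\<in>{a \<in> A. F1 a = \<gamma> \<and> t a = n}. E (h a) m) =
               (\<Sum>b\<in>{b \<in> A. F1 b = \<gamma> \<and> h b = m}. E n (t b))) \<and>
     (\<exists>n m. E n m \<noteq> 0) \<and> (\<exists>n\<in>V. E n n \<noteq> 1)"

text \<open>Transposing the matrix while exchanging tails and heads swaps the two sides of the
  commutation clause. This duality, the reason for the parameters \<open>t\<close> and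
  \<open>h\<close>, carries one orientation of the connecting arrows to the other.\<close>

lemma idempotent_matrix_transpose:
  assumes "idempotent_matrix V A t h F0 F1 E"
  shows "idempotent_matrix V A h t F0 F1 (\<lambda>n m. E m n)"
  using assms unfolding idempotent_matrix_def by (simp add: mult.commute) metis

lemma decomposable_if_idempotent_matrix:
  fixes T :: "(nat,'a) pre_digraph" and E :: "nat \<Rightarrow> nat \<Rightarrow> 'k::field"
  assumes Q: "zero_relation_quiver TYPE('k) Q \<rho>" and T: "fin_digraph T"
    and F: "bound_quiver_morphism TYPE('k) T Q \<rho> F0 F1"
    and E: "idempotent_matrix (verts T) (arcs T) (tail T) (head T) F0 F1 E"
  shows "decomposable Q \<rho> (tree_module T F0 F1 :: ('k,'v,'q, nat \<Rightarrow>\<^sub>0 'k) rep)"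
proof -
  interpret fin_digraph T by fact
  let ?M = "tree_module T F0 F1 :: ('k,'v,'q, nat \<Rightarrow>\<^sub>0 'k) rep"
  have scl: "scl ?M = (\<lambda>c. Poly_Mapping.map ((*) c))"
    and space: "space ?M v = {x. Poly_Mapping.keys x \<subseteq> {n \<in> verts T. F0 n = v}}" for v
    by (simp_all add: tree_module_def)
  have supp: "n \<in> verts T \<and> m \<in> verts T \<and> F0 n = F0 m" if "E n m \<noteq> 0" for n m
    using E that unfolding idempotent_matrix_def by blast
  have idem: "(\<Sum>p\<in>verts T. E n p * E p m) = E n m" for n m
    using E unfolding idempotent_matrix_def by blast
  have comm: "(\<Sum>a\<in>{a \<in> arcs T. F1 a = \<gamma> \<and> tail T a = n}. E (head T a) m) =
      (\<Sum>b\<in>{b \<in> arcs T. F1 b = \<gamma> \<and> head T b = m}. E n (tail T b))" for \<gamma> n m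
    using E unfolding idempotent_matrix_def by blast
  define e :: "(nat \<Rightarrow>\<^sub>0 'k) \<Rightarrow> (nat \<Rightarrow>\<^sub>0 'k)" where
    "e x = (\<Sum>m\<in>verts T. Poly_Mapping.single m (\<Sum>n\<in>verts T. E n m * Poly_Mapping.lookup x n))" for x
  have e: "Poly_Mapping.lookup (e x) m = (\<Sum>n\<in>verts T. E n m * Poly_Mapping.lookup x n)" for x m
  proof -
    \<comment> \<open>The formula must also hold for \<open>m\<close> outside the tree, where
      \<open>e x\<close> has no entry; there the column of \<open>E\<close> vanishes.\<close>
    have "(\<Sum>n\<in>verts T. E n m * Poly_Mapping.lookup x n) = 0" if "m \<notin> verts T"
      using that supp by (intro sum.neutral) auto
    then show ?thesis
      by (auto simp: e_def lookup_sum lookup_single when_def sum.delta)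
  qed
  note act = lookup_tree_act[OF T]
  have e_closed: "e x \<in> space ?M v" if "x \<in> space ?M v" for x v
  proof -
    have "m \<in> verts T \<and> F0 m = v" if nz: "Poly_Mapping.lookup (e x) m \<noteq> 0" for m
    proof -
      obtain n where "E n m * Poly_Mapping.lookup x n \<noteq> 0"
        using nz unfolding e by (rule sum.not_neutral_contains_not_neutral)
      then show ?thesis
        using supp[of n m] \<open>x \<in> space ?M v\<close> by (auto simp: space in_keys_iff)
    qed
    then show ?thesis by (auto simp: space in_keys_iff)
  qed
  have e_comm: "e (act ?M \<gamma> x) = act ?M \<gamma> (e x)" for \<gamma> x
  proof (rule poly_mapping_eqI)
    fix m
    let ?A = "{a \<in> arcs T. F1 a = \<gamma>}"
    have "Poly_Mapping.lookup (e (act ?M \<gamma> x)) m =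
        (\<Sum>n\<in>verts T. \<Sum>a\<in>{a \<in> ?A. head T a = n}. E (head T a) m * Poly_Mapping.lookup x (tail T a))"
      by (auto simp: e act sum_distrib_left conj_assoc intro!: sum.cong)
    also have "\<dots> = (\<Sum>a\<in>?A. E (head T a) m * Poly_Mapping.lookup x (tail T a))"
      by (rule sum.group) auto
    \<comment> \<open>The same sum over arrows, so far grouped by head, is regrouped by tail so that
      \<open>comm\<close> applies.\<close>
    also have "\<dots> = (\<Sum>n\<in>verts T. \<Sum>a\<in>{a \<in> ?A. tail T a = n}. E (head T a) m * Poly_Mapping.lookup x (tail T a))"
      by (rule sum.group[symmetric]) auto
    also have "\<dots> = (\<Sum>n\<in>verts T. (\<Sum>a\<in>{a \<in> arcs T. F1 a = \<gamma> \<and> tail T a = n}. E (head T a) m) * Poly_Mapping.lookup x n)"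
      by (auto simp: sum_distrib_right conj_assoc intro!: sum.cong)
    also have "\<dots> = (\<Sum>n\<in>verts T. \<Sum>b\<in>{b \<in> arcs T. F1 b = \<gamma> \<and> head T b = m}. E n (tail T b) * Poly_Mapping.lookup x n)"
      by (simp add: comm sum_distrib_right)
    also have "\<dots> = Poly_Mapping.lookup (act ?M \<gamma> (e x)) m"
      unfolding e act by (rule sum.swap)
    finally show "Poly_Mapping.lookup (e (act ?M \<gamma> x)) m = Poly_Mapping.lookup (act ?M \<gamma> (e x)) m" .
  qed
  have e_idem: "e (e x) = e x" for x
  proof (rule poly_mapping_eqI)
    fix m
    have "Poly_Mapping.lookup (e (e x)) m =
        (\<Sum>p\<in>verts T. \<Sum>n\<in>verts T. E n p * E p m * Poly_Mapping.lookup x n)"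
      by (auto simp: e sum_distrib_left mult_ac intro!: sum.cong)
    also have "\<dots> = (\<Sum>n\<in>verts T. \<Sum>p\<in>verts T. E n p * E p m * Poly_Mapping.lookup x n)"
      by (rule sum.swap)
    also have "\<dots> = Poly_Mapping.lookup (e x) m"
      by (simp add: e idem flip: sum_distrib_right)
    finally show "Poly_Mapping.lookup (e (e x)) m = Poly_Mapping.lookup (e x) m" .
  qed
  have e_single: "Poly_Mapping.lookup (e (Poly_Mapping.single n 1)) m = E n m" if "n \<in> verts T" for n m
    using that by (simp add: e lookup_single when_def if_distrib sum.delta cong: if_cong)
  have single: "Poly_Mapping.single n 1 \<in> space ?M (F0 n)" if "n \<in> verts T" for n
    using that by (simp add: space)
  obtain n m where nm: "E n m \<noteq> 0"
    using E unfolding idempotent_matrix_def by blast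
  obtain p where p: "p \<in> verts T" "E p p \<noteq> 1"
    using E unfolding idempotent_matrix_def by blast
  have F0: "F0 n \<in> verts Q" if "n \<in> verts T" for n
    using F that by (simp add: bound_quiver_morphism_def)
  show ?thesis
  proof (rule decomposable_if_idempotent_endomorphism)
    show "bound_rep Q \<rho> ?M"
      using Q T F by (rule bound_rep_tree_module)
    show "wf_digraph Q" "\<rho> \<subseteq> qpaths Q"
      using Q by (auto simp: zero_relation_quiver_def)
    show "e (x + y) = e x + e y" for x y
      by (rule poly_mapping_eqI) (simp add: e lookup_add algebra_simps sum.distrib)
    show "e (scl ?M c x) = scl ?M c (e x)" for c x
      by (rule poly_mapping_eqI) (simp add: e scl lookup_map_scale sum_distrib_left mult_ac)
    show "F0 n \<in> verts Q" "Poly_Mapping.single n 1 \<in> space ?M (F0 n)"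
      using supp[OF nm] F0[of n] single[of n] by blast+
    show "e (Poly_Mapping.single n 1) \<noteq> 0"
      using e_single[of n m] supp[OF nm] nm by auto
    show "F0 p \<in> verts Q" "Poly_Mapping.single p 1 \<in> space ?M (F0 p)"
      using p F0[of p] single[of p] by blast+
    show "e (Poly_Mapping.single p 1) \<noteq> Poly_Mapping.single p 1"
      using e_single[of p p] p by auto
  qed (simp_all add: e_closed e_comm e_idem)
qed

text \<open>
  The witness is the projection onto the second branch that kills \<open>v\<^sub>n + \<Sum> {v\<^sub>m | C n m}\<close> for \<open>n\<close> in
  the first branch.
\<close>

lemma idempotent_matrix_graph:
  fixes t h :: "'a \<Rightarrow> 'n" and F0 :: "'n \<Rightarrow> 'v" and F1 :: "'a \<Rightarrow> 'q"
  assumes fin: "finite V" "finite A"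
    and V: "r \<in> V" "V1 \<subseteq> V" "V2 \<subseteq> V" "V1 \<inter> V2 = {}" "r \<notin> V1" "r \<notin> V2"
    and A: "A1 \<subseteq> A" "A2 \<subseteq> A" "a1 \<in> A" "a2 \<in> A" "F1 a1 = F1 a2"
    and A1: "\<And>a. a \<in> A1 \<Longrightarrow> t a \<in> V1 \<and> h a \<in> V1"
      "\<And>a. a \<in> A \<Longrightarrow> t a \<in> V1 \<Longrightarrow> a \<in> A1" "\<And>a. a \<in> A \<Longrightarrow> h a \<in> V1 \<Longrightarrow> a \<in> A1 \<or> a = a1"
      "\<And>a b. a \<in> A1 \<Longrightarrow> b \<in> A1 \<Longrightarrow> F1 a = F1 b \<Longrightarrow> t a = t b \<Longrightarrow> a = b"
    and A2: "\<And>a. a \<in> A2 \<Longrightarrow> t a \<in> V2 \<and> h a \<in> V2"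
      "\<And>a. a \<in> A \<Longrightarrow> t a \<in> V2 \<Longrightarrow> a \<in> A2" "\<And>a. a \<in> A \<Longrightarrow> h a \<in> V2 \<Longrightarrow> a \<in> A2 \<or> a = a2"
      "\<And>a b. a \<in> A2 \<Longrightarrow> b \<in> A2 \<Longrightarrow> F1 a = F1 b \<Longrightarrow> h a = h b \<Longrightarrow> a = b"
    and roots: "t a1 = r" "h a1 = x" "t a2 = r" "h a2 = y" "x \<in> V1" "y \<in> V2"
    and C: "\<And>n m. C n m \<Longrightarrow> n \<in> V1 \<and> m \<in> V2 \<and> F0 n = F0 m" "C x y"
      "\<And>n m. C n m \<Longrightarrow> n = x \<longleftrightarrow> m = y"
      "\<And>a m. a \<in> A1 \<Longrightarrow> C (h a) m \<Longrightarrow> \<exists>b\<in>A2. h b = m \<and> F1 a = F1 b \<and> C (t a) (t b)"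
      "\<And>b n. b \<in> A2 \<Longrightarrow> C n (t b) \<Longrightarrow> \<exists>a\<in>A1. t a = n \<and> F1 a = F1 b \<and> C (h a) (h b)"
  shows "\<exists>E :: 'n \<Rightarrow> 'n \<Rightarrow> 'k::field. idempotent_matrix V A t h F0 F1 E"
proof -
  \<comment> \<open>\<open>D\<close> is the coordinate projection onto the span of \<open>V2\<close>
    and \<open>H\<close> the matrix of the map defined by \<open>C\<close>. With the minus sign,
    \<open>E\<close> sends \<open>v_n\<close> in the first branch to the negative of its image under
    \<open>H\<close>.\<close>
  define D :: "'n \<Rightarrow> 'n \<Rightarrow> 'k" where "D n m = of_bool (n = m \<and> m \<in> V2)" for n m
  define H :: "'n \<Rightarrow> 'n \<Rightarrow> 'k" where "H n m = of_bool (C n m)" for n m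
  define E where "E n m = D n m - H n m" for n m
  have outside: "D n m = 0" "H n m = 0" if "m \<notin> V2" for n m
    using that C(1) by (auto simp: D_def H_def)
  have inside: "E p m = of_bool (p = m)" if "p \<in> V2" for p m
    using that C(1) V(4) by (auto simp: E_def D_def H_def)
  have idem: "(\<Sum>p\<in>V. E n p * E p m) = E n m" for n m
  proof -
    \<comment> \<open>The image of \<open>E\<close> lies in the span of \<open>V2\<close>, on which
      \<open>E\<close> is the identity.\<close>
    have "E n p * E p m = (if p = m then E n p else 0)" for p
      using inside[of p m] outside[of p n] by (cases "p \<in> V2") (auto simp: E_def)
    then have "(\<Sum>p\<in>V. E n p * E p m) = (\<Sum>p\<in>V. if p = m then E n p else 0)"
      by simp
    also have "\<dots> = E n m"
      using fin(1) V(3) outside[of m n] by (cases "m \<in> V2") (auto simp: sum.delta E_def)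
    finally show ?thesis .
  qed
  have comm: "(\<Sum>a\<in>{a \<in> A. F1 a = \<gamma> \<and> t a = n}. E (h a) m) =
      (\<Sum>b\<in>{b \<in> A. F1 b = \<gamma> \<and> h b = m}. E n (t b))" for \<gamma> n m
  proof -
    let ?out = "{a \<in> A. F1 a = \<gamma> \<and> t a = n}" and ?in = "{b \<in> A. F1 b = \<gamma> \<and> h b = m}"
    \<comment> \<open>Neither \<open>D\<close> nor \<open>H\<close> commutes with the arrows on its
      own. Each fails only at \<open>r\<close>: \<open>D\<close> because \<open>a2\<close> enters
      the second branch there, \<open>H\<close> because \<open>a1\<close> leads to \<open>x\<close>
      and \<open>C\<close> pairs \<open>x\<close> with \<open>y\<close>. Both defects equal
      \<open>?root\<close> and cancel in \<open>E\<close>.\<close>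
    let ?root = "of_bool (F1 a2 = \<gamma> \<and> n = r \<and> m = y) :: 'k"
    \<comment> \<open>Unramifiedness lets at most one arrow contribute to each sum of entries of
      \<open>H\<close>. The sums thus become truth values of existence statements, which the lifting
      properties of \<open>C\<close> compare.\<close>
    have card_le: "(\<Sum>a\<in>S. of_bool (P a)) = (of_bool (\<exists>a\<in>S. P a) :: 'k)"
      if "finite S" "\<And>a b. a \<in> S \<Longrightarrow> b \<in> S \<Longrightarrow> P a \<Longrightarrow> P b \<Longrightarrow> a = b" for S and P :: "'a \<Rightarrow> bool"
    proof (cases "\<exists>a\<in>S. P a")
      case True
      then obtain a where a: "a \<in> S" "P a" by blast
      then have "(\<Sum>b\<in>S. of_bool (P b)) = (\<Sum>b\<in>S. if b = a then 1 else (0::'k))"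
        using that(2) by (intro sum.cong) auto
      then show ?thesis using a that(1) by (auto simp: sum.delta)
    qed auto
    have D_out: "(\<Sum>a\<in>?out. D (h a) m) = (\<Sum>a\<in>{a \<in> A. F1 a = \<gamma> \<and> t a = n \<and> h a = m \<and> m \<in> V2}. 1)"
      using fin(2) by (auto simp: D_def sum.If_cases of_bool_def intro!: arg_cong[where f = of_nat] arg_cong[where f = card])
    have D_in: "(\<Sum>b\<in>?in. D n (t b)) = (\<Sum>a\<in>{a \<in> A. F1 a = \<gamma> \<and> t a = n \<and> h a = m \<and> n \<in> V2}. 1)"
      using fin(2) by (auto simp: D_def sum.If_cases of_bool_def intro!: arg_cong[where f = of_nat] arg_cong[where f = card])
    define X where "X = {a \<in> A. F1 a = \<gamma> \<and> t a = n \<and> h a = m \<and> n \<in> V2}"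
    define R where "R = {a. a = a2 \<and> F1 a2 = \<gamma> \<and> n = r \<and> m = y}"
    have "{a \<in> A. F1 a = \<gamma> \<and> t a = n \<and> h a = m \<and> m \<in> V2} = X \<union> R"
      unfolding X_def R_def using A A2(1-3) V roots by blast
    moreover have "X \<inter> R = {}" "finite X" "finite R"
      using V roots fin(2) by (auto simp: X_def R_def)
    moreover have "(\<Sum>a\<in>R. 1) = ?root"
      by (auto simp: R_def)
    ultimately have D_eq: "(\<Sum>a\<in>?out. D (h a) m) = (\<Sum>b\<in>?in. D n (t b)) + ?root"
      unfolding D_out D_in X_def[symmetric] by (simp only: sum.union_disjoint)
    have H_in: "(\<Sum>b\<in>?in. H n (t b)) = of_bool (\<exists>b\<in>?in. C n (t b))"
    proof (unfold H_def, rule card_le)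
      fix a b assume ab: "a \<in> ?in" "b \<in> ?in" "C n (t a)" "C n (t b)"
      then have "a \<in> A2" "b \<in> A2"
        using C(1) A2(2) by auto
      then show "a = b" using ab A2(4)[of a b] by simp
    qed (use fin in auto)
    have H_out: "(\<Sum>a\<in>?out. H (h a) m) = of_bool (\<exists>a\<in>?out. C (h a) m)"
    proof (unfold H_def, rule card_le)
      fix a b assume ab: "a \<in> ?out" "b \<in> ?out" "C (h a) m" "C (h b) m"
      then have "a \<in> A1 \<or> a = a1" "b \<in> A1 \<or> b = a1"
        using C(1) A1(3) by auto
      moreover have "t a = t b" "F1 a = F1 b" using ab by auto
      ultimately show "a = b" using A1(1)[of a] A1(1)[of b] A1(4)[of a b] roots V by auto
    qed (use fin in auto)
    have H_eq: "(\<exists>a\<in>?out. C (h a) m) \<longleftrightarrow> (\<exists>b\<in>?in. C n (t b)) \<or> F1 a2 = \<gamma> \<and> n = r \<and> m = y"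
    proof
      assume "\<exists>a\<in>?out. C (h a) m"
      then obtain a where a: "a \<in> ?out" "C (h a) m" by blast
      then have "a \<in> A1 \<or> a = a1" using C(1) A1(3) by auto
      then show "(\<exists>b\<in>?in. C n (t b)) \<or> F1 a2 = \<gamma> \<and> n = r \<and> m = y"
      proof
        assume "a \<in> A1"
        then show ?thesis using C(4)[of a m] a A(2) by auto
      next
        assume "a = a1"
        then show ?thesis using a C(3) roots A(5) by auto
      qed
    next
      assume "(\<exists>b\<in>?in. C n (t b)) \<or> F1 a2 = \<gamma> \<and> n = r \<and> m = y"
      then show "\<exists>a\<in>?out. C (h a) m"
      proof
        assume "\<exists>b\<in>?in. C n (t b)"
        then obtain b where b: "b \<in> ?in" "C n (t b)" by blast
        then have "b \<in> A2" using C(1) A2(2) by auto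
        then show ?thesis using C(5)[of b n] b A(1) by auto
      next
        assume "F1 a2 = \<gamma> \<and> n = r \<and> m = y"
        then show ?thesis using roots A C(2) by (intro bexI[of _ a1]) auto
      qed
    qed
    \<comment> \<open>The alternatives in \<open>H_eq\<close> exclude each other because
      \<open>r\<close> is outside \<open>V1\<close>; hence the truth value of the disjunction is a
      sum.\<close>
    have "\<not> (\<exists>b\<in>?in. C n (t b))" if "F1 a2 = \<gamma> \<and> n = r \<and> m = y"
      using that C(1) V by auto
    then have "(\<Sum>a\<in>?out. H (h a) m) = (\<Sum>b\<in>?in. H n (t b)) + ?root"
      unfolding H_in H_out H_eq by auto
    with D_eq show ?thesis
      by (simp add: E_def sum_subtractf)
  qed
  have "E n m \<noteq> 0 \<longrightarrow> n \<in> V \<and> m \<in> V \<and> F0 n = F0 m" for n m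
    using C(1)[of n m] V by (auto simp: E_def D_def H_def)
  \<comment> \<open>\<open>v_y\<close> is fixed and \<open>v_r\<close> is killed, so
    \<open>E\<close> is neither zero nor the identity.\<close>
  moreover have "E y y \<noteq> 0" using inside[of y] roots by simp
  moreover have "E r r \<noteq> 1" using outside[of r r] V by (simp add: E_def)
  ultimately have "idempotent_matrix V A t h F0 F1 E"
    using idem comm V(1) unfolding idempotent_matrix_def by blast
  then show ?thesis by blast
qed

section \<open>Trees branching at a vertex\<close>

text \<open>\<open>ends\<close> admits both orientations of the connecting arrows, so that (A) and
  (B) share the analysis of the branches.\<close>

locale branched_tree =
  fixes T :: "(nat,'a) pre_digraph" and k S a src tgt and F1 :: "'a \<Rightarrow> 'q"
  assumes shape: "tree_shape T k S a src tgt"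
    and ends: "src = (\<lambda>j. 0) \<and> tgt = (\<lambda>j. j) \<or> src = (\<lambda>j. j) \<and> tgt = (\<lambda>j. 0)"
    and branches_unramified: "branches_unramified T k S F1"
    and connecting_label: "\<forall>j\<in>{1..k}. F1 (a 1) = F1 (a j)"
begin

lemma fin_digraph_T: "fin_digraph T"
  using shape by (simp add: tree_shape_def tree_quiver_def)

lemma branch_subgraph: "j \<in> {0..k} \<Longrightarrow> subgraph (S j) T"
  using shape by (simp add: tree_shape_def)

lemma branch_tree_quiver: "j \<in> {0..k} \<Longrightarrow> tree_quiver (S j)"
  using shape by (simp add: tree_shape_def)

lemma branch_wf_digraph: "j \<in> {0..k} \<Longrightarrow> wf_digraph (S j)"
  using branch_subgraph by (simp add: subgraph_def)

lemma branch_verts_subset: "j \<in> {0..k} \<Longrightarrow> verts (S j) \<subseteq> verts T"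
  using branch_subgraph by (simp add: subgraph_def)

lemma branch_arcs_subset: "j \<in> {0..k} \<Longrightarrow> arcs (S j) \<subseteq> arcs T"
  using branch_subgraph by (simp add: subgraph_def)

lemma branch_tail_head:
  assumes "j \<in> {0..k}"
  shows "tail (S j) = tail T" "head (S j) = head T"
  using branch_subgraph[OF assms] by (simp_all add: subgraph_def compatible_def)

lemma branch_arc_ends:
  assumes "j \<in> {0..k}" "e \<in> arcs (S j)"
  shows "tail T e \<in> verts (S j)" "head T e \<in> verts (S j)"
  using wf_digraph.tail_in_verts[OF branch_wf_digraph[OF assms(1)] assms(2)]
    wf_digraph.head_in_verts[OF branch_wf_digraph[OF assms(1)] assms(2)] branch_tail_head[OF assms(1)]
  by simp_all

lemma root_in_branch: "j \<in> {0..k} \<Longrightarrow> j \<in> verts (S j)"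
  using shape by (simp add: tree_shape_def)

lemma zero_in_T: "0 \<in> verts T"
  using root_in_branch[of 0] branch_verts_subset[of 0] by auto

lemma branches_disjoint:
  "i \<in> {0..k} \<Longrightarrow> j \<in> {0..k} \<Longrightarrow> i \<noteq> j \<Longrightarrow> verts (S i) \<inter> verts (S j) = {}"
  using shape by (simp add: tree_shape_def)

lemma zero_notin_branch: "j \<in> {1..k} \<Longrightarrow> 0 \<notin> verts (S j)"
  using branches_disjoint[of 0 j] root_in_branch[of 0] by auto

lemma connecting_arc:
  assumes "j \<in> {1..k}"
  shows "a j \<in> arcs T" "tail T (a j) = src j" "head T (a j) = tgt j"
  using shape assms by (auto simp: tree_shape_def)

lemma connecting_arcs_same_label:
  assumes "i \<in> {1..k}" "j \<in> {1..k}"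
  shows "F1 (a i) = F1 (a j)"
  using bspec[OF connecting_label assms(1)] bspec[OF connecting_label assms(2)] by (rule trans[OF sym])

lemma connecting_arc_notin_branch: "j \<in> {1..k} \<Longrightarrow> a j \<notin> arcs (S j)"
  using branch_arc_ends[of j "a j"] connecting_arc[of j] ends zero_notin_branch[of j] by auto

text \<open>The vertex sets are disjoint, so arrows of another \<open>S i\<close> and other
  connecting arrows have both ends outside \<open>S j\<close>.\<close>

lemma arc_at_branch:
  assumes j: "j \<in> {1..k}" and e: "e \<in> arcs T"
    and "tail T e \<in> verts (S j) \<or> head T e \<in> verts (S j)"
  shows "e \<in> arcs (S j) \<or> e = a j"
proof -
  consider i where "i \<in> {0..k}" "e \<in> arcs (S i)" | i where "i \<in> {1..k}" "e = a i"
    using e shape by (auto simp: tree_shape_def)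
  then show ?thesis
  proof cases
    case 1
    then have "i = j"
      using branches_disjoint[of i j] branch_arc_ends[of i e] assms by auto
    with 1 show ?thesis by simp
  next
    case 2
    then have "i \<in> verts (S j)"
      using assms(3) j connecting_arc[of i] ends zero_notin_branch[of j] by auto
    then have "i = j"
      using 2 j branches_disjoint[of i j] root_in_branch[of i] by auto
    with 2 show ?thesis by simp
  qed
qed

text \<open>The induced subtree contains \<open>a j\<close> besides the arrows of
  \<open>S j\<close>. Comparison with \<open>a j\<close> later excludes lifts that leave the
  branch.\<close>

lemma branch_arcs_injective:
  assumes j: "j \<in> {1..k}" and "e \<in> insert (a j) (arcs (S j))" "e' \<in> insert (a j) (arcs (S j))"
    and "F1 e = F1 e'" "tail T e = tail T e' \<or> head T e = head T e'"
  shows "e = e'"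
proof -
  have "d \<in> arcs (T \<restriction> (verts (S j) \<union> {0}))" if "d \<in> insert (a j) (arcs (S j))" for d
    using that j branch_arc_ends[of j d] branch_arcs_subset[of j] connecting_arc[OF j] ends
      root_in_branch[of j] by auto
  then show ?thesis
    using assms branches_unramified unfolding branches_unramified_def by blast
qed

lemma unramified_branch: "j \<in> {1..k} \<Longrightarrow> unramified (S j) F1"
  using branch_arcs_injective[of j] branch_tail_head[of j] by (auto simp: unramified_def)

text \<open>Edges of the pullback network join distinct vertices. This excludes the choice of the
  given arrow itself in the edge alternatives of completeness.\<close>

lemma covering_network_no_vertical_edge:
  "{(n, m, j), (n, m, i)} \<notin> edges (covering_network T F0 F1)"
proof
  assume "{(n, m, j), (n, m, i)} \<in> edges (covering_network T F0 F1)"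
  then have "{(n, m)} \<in> edges (pullback_network T F0 F1)"
    by (auto simp: covering_network_def doubleton_eq_iff)
  then show False
    by (auto simp: pullback_network_def)
qed

end

section \<open>The component of a pair of roots inside the graph map\<close>

text \<open>One sign \<open>j\<close> suffices, since the network is explored from
  \<open>(x, y, j)\<close> along arrows only, and these preserve the sign.\<close>

locale complete_branched_tree = branched_tree +
  fixes F0 :: "nat \<Rightarrow> 'v" and G :: "(nat \<times> nat \<times> int, 'a \<times> 'a \<times> int) network" and x y j
  assumes subnetwork: "subnetwork G (covering_network T F0 F1)"
    and complete: "complete_network T F1 G"
    and x: "x \<in> {1..k}" and y: "y \<in> {1..k}" and xy: "(x, y, j) \<in> net_verts G"
begin

abbreviation C :: "nat \<Rightarrow> nat \<Rightarrow> bool" where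
  "C \<equiv> pullback_component (S x) (S y) F1 x y"

lemma no_vertical_edge: "{(n, m, i), (n, m, -i)} \<notin> edges G"
  using covering_network_no_vertical_edge[of n m i "- i" F0] subnetwork unfolding subnetwork_def by blast

lemma arc_in_network:
  assumes "(b, c, i) \<in> net_arcs G"
  shows "F1 b = F1 c" "(tail T b, tail T c, i) \<in> net_verts G" "(head T b, head T c, i) \<in> net_verts G"
proof -
  have "subgraph (quiver G) (quiver (covering_network T F0 F1))"
    using subnetwork by (simp add: subnetwork_def)
  then have sub: "net_arcs G \<subseteq> net_arcs (covering_network T F0 F1)" "wf_digraph (quiver G)"
      "tail (quiver G) = tail (quiver (covering_network T F0 F1))"
      "head (quiver G) = head (quiver (covering_network T F0 F1))"
    by (simp_all add: subgraph_def compatible_def)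
  show "F1 b = F1 c"
    using sub(1) assms by (auto simp: covering_network_def pullback_network_def)
  show "(tail T b, tail T c, i) \<in> net_verts G" "(head T b, head T c, i) \<in> net_verts G"
    using wf_digraph.tail_in_verts[OF sub(2) assms] wf_digraph.head_in_verts[OF sub(2) assms] sub(3,4)
    by (simp_all add: covering_network_def)
qed

text \<open>The edge alternative of completeness needs an arrow with the label and tail of
  \<open>b\<close>. Unramifiedness makes it \<open>b\<close> itself, and the edge would be vertical.
  So an arrow of \<open>G\<close> exists, whose second entry may still be
  \<open>a y\<close>.\<close>

lemma incoming_arc_lifts:
  assumes "(n, m, j) \<in> net_verts G" "m \<in> verts (S y)" "b \<in> arcs (S x)" "head T b = n"
  shows "\<exists>c\<in>insert (a y) (arcs (S y)). head T c = m \<and> F1 b = F1 c \<and> (tail T b, tail T c, j) \<in> net_verts G"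
proof -
  have bT: "b \<in> arcs T" "tail T b \<in> verts (S x)"
    using assms x branch_arcs_subset[of x] branch_arc_ends[of x b] by auto
  have "c = b" if "c \<in> arcs T" "tail T c = tail T b" "F1 b = F1 c" for c
    using that bT assms(3) arc_at_branch[OF x that(1)] branch_arcs_injective[OF x, of c b] by auto
  moreover have "(\<exists>c\<in>arcs T. head T c = m \<and> (b, c, j) \<in> net_arcs G) \<or>
      (\<exists>c\<in>arcs T. tail T c = tail T b \<and> F1 b = F1 c \<and> {(n, m, j), (head T c, m, -j)} \<in> edges G)"
    using bspec[OF complete[unfolded complete_network_def] assms(1), simplified] bT(1) assms(4) by blast
  ultimately obtain c where "c \<in> arcs T" "head T c = m" "(b, c, j) \<in> net_arcs G"
    using no_vertical_edge[of n m j] assms(4) by metis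
  then show ?thesis
    using arc_in_network[of b c j] arc_at_branch[OF y, of c] assms(2) by blast
qed

text \<open>Dually, the edge alternative needs an arrow with the label and head of \<open>b\<close>,
  which can only be \<open>b\<close>.\<close>

lemma outgoing_arc_lifts:
  assumes "(n, m, j) \<in> net_verts G" "n \<in> verts (S x)" "b \<in> arcs (S y)" "tail T b = m"
  shows "\<exists>c\<in>insert (a x) (arcs (S x)). tail T c = n \<and> F1 c = F1 b \<and> (head T c, head T b, j) \<in> net_verts G"
proof -
  have bT: "b \<in> arcs T" "head T b \<in> verts (S y)"
    using assms y branch_arcs_subset[of y] branch_arc_ends[of y b] by auto
  have "d = b" if "d \<in> arcs T" "head T d = head T b" "F1 b = F1 d" for d
    using that bT assms(3) arc_at_branch[OF y that(1)] branch_arcs_injective[OF y, of d b] by auto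
  moreover have "(\<exists>c\<in>arcs T. tail T c = n \<and> (c, b, j) \<in> net_arcs G) \<or>
      (\<exists>d\<in>arcs T. head T d = head T b \<and> F1 b = F1 d \<and> {(n, m, j), (n, tail T d, -j)} \<in> edges G)"
    using bspec[OF complete[unfolded complete_network_def] assms(1), simplified] bT(1) assms(4) by blast
  ultimately obtain c where "c \<in> arcs T" "tail T c = n" "(c, b, j) \<in> net_arcs G"
    using no_vertical_edge[of n m j] assms(4) by metis
  then show ?thesis
    using arc_in_network[of c b j] arc_at_branch[OF x, of c] assms(2) by blast
qed

lemma component_in_branches: "C n m \<Longrightarrow> n \<in> verts (S x) \<and> m \<in> verts (S y)"
  using pullback_component_subset[of "S x" "S y" x y F1 n m] branch_wf_digraph root_in_branch x y
  by simp

lemma component_at_root: "C n m \<Longrightarrow> n = x \<longleftrightarrow> m = y"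
  using pullback_component_injective_at_root[of "S x" "S y" F1 x y n m] branch_tree_quiver
    unramified_branch root_in_branch x y by simp

text \<open>Completeness lifts one arrow of each pair to some arrow at the other vertex. The given
  partner has the same label and the same end there, so the lift is that partner.\<close>

lemma component_in_network: "C n m \<Longrightarrow> (n, m, j) \<in> net_verts G"
proof (induction rule: pullback_component.induct)
  case base
  show ?case by (rule xy)
next
  case (forward b c)
  have ends': "tail T b \<in> verts (S x)"
    using forward x branch_arc_ends[of x b] by simp
  obtain d where "d \<in> insert (a x) (arcs (S x))" "tail T d = tail T b" "F1 d = F1 c"
      "(head T d, head T c, j) \<in> net_verts G"
    using outgoing_arc_lifts[of "tail T b" "tail T c" c] forward ends' x y
    by (auto simp: branch_tail_head)
  then show ?case
    using forward branch_arcs_injective[OF x, of d b] x y by (auto simp: branch_tail_head)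
next
  case (backward b c)
  have ends': "head T c \<in> verts (S y)"
    using backward y branch_arc_ends[of y c] by simp
  obtain d where "d \<in> insert (a y) (arcs (S y))" "head T d = head T c" "F1 b = F1 d"
      "(tail T b, tail T d, j) \<in> net_verts G"
    using incoming_arc_lifts[of "head T b" "head T c" b] backward ends' x y
    by (auto simp: branch_tail_head)
  then show ?case
    using backward branch_arcs_injective[OF y, of d c] x y by (auto simp: branch_tail_head)
qed

text \<open>The lift could leave the branch only through \<open>a y\<close>, and then
  \<open>m = y\<close>. By \<open>component_at_root\<close> the arrow \<open>b\<close> ends at
  \<open>x\<close> with the label of \<open>a x\<close>, so it would be \<open>a x\<close>, which is
  not in \<open>S x\<close>.\<close>

lemma component_incoming:
  assumes "b \<in> arcs (S x)" "C (head T b) m"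
  shows "\<exists>c\<in>arcs (S y). head T c = m \<and> F1 b = F1 c \<and> C (tail T b) (tail T c)"
proof -
  have mem: "head T b \<in> verts (S x)" "m \<in> verts (S y)"
    using component_in_branches[OF assms(2)] by auto
  obtain c where c: "c \<in> insert (a y) (arcs (S y))" "head T c = m" "F1 b = F1 c"
    using incoming_arc_lifts[OF component_in_network[OF assms(2)]] assms(1) mem by blast
  have "c \<noteq> a y"
  proof
    assume "c = a y"
    then have m: "m = y" and tgt: "tgt = (\<lambda>j. j)"
      using c(2) mem y connecting_arc[OF y] ends zero_notin_branch[OF y] by auto
    then have "head T b = head T (a x)"
      using component_at_root[OF assms(2)] connecting_arc[OF x] by simp
    moreover have "F1 b = F1 (a x)"
      using c(3) \<open>c = a y\<close> connecting_arcs_same_label[OF x y] by simp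
    ultimately have "b = a x"
      using branch_arcs_injective[OF x, of b "a x"] assms(1) by simp
    then show False
      using connecting_arc_notin_branch[OF x] assms(1) by simp
  qed
  with c have "c \<in> arcs (S y)" by simp
  then show ?thesis
    using c assms pullback_component.backward[of "S x" "S y" F1 x y b c] x y
    by (auto simp: branch_tail_head)
qed

text \<open>A lift to \<open>a x\<close> would give \<open>n = x\<close>, so that \<open>b\<close>
  starts at \<open>y\<close> with the label of \<open>a y\<close>; this forces
  \<open>b = a y\<close>, which is not in \<open>S y\<close>.\<close>

lemma component_outgoing:
  assumes "b \<in> arcs (S y)" "C n (tail T b)"
  shows "\<exists>c\<in>arcs (S x). tail T c = n \<and> F1 c = F1 b \<and> C (head T c) (head T b)"
proof -
  have mem: "n \<in> verts (S x)" "tail T b \<in> verts (S y)"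
    using component_in_branches[OF assms(2)] by auto
  obtain c where c: "c \<in> insert (a x) (arcs (S x))" "tail T c = n" "F1 c = F1 b"
    using outgoing_arc_lifts[OF component_in_network[OF assms(2)]] assms(1) mem by blast
  have "c \<noteq> a x"
  proof
    assume "c = a x"
    then have n: "n = x" and src: "src = (\<lambda>j. j)"
      using c(2) mem x connecting_arc[OF x] ends zero_notin_branch[OF x] by auto
    then have "tail T b = tail T (a y)"
      using component_at_root[OF assms(2)] connecting_arc[OF y] by simp
    moreover have "F1 b = F1 (a y)"
      using c(3) \<open>c = a x\<close> connecting_arcs_same_label[OF x y] by simp
    ultimately have "b = a y"
      using branch_arcs_injective[OF y, of b "a y"] assms(1) by simp
    then show False
      using connecting_arc_notin_branch[OF y] assms(1) by simp
  qed
  with c have "c \<in> arcs (S x)" by simp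
  then show ?thesis
    using c assms pullback_component.forward[of "S x" "S y" F1 x y c b] x y
    by (auto simp: branch_tail_head)
qed

lemma component_same_vertex:
  assumes "C n m" shows "F0 n = F0 m"
proof -
  have "net_verts G \<subseteq> net_verts (covering_network T F0 F1)"
    using subnetwork by (simp add: subnetwork_def subgraph_def)
  then show ?thesis
    using component_in_network[OF assms]
    by (auto simp: covering_network_def pullback_network_def pullback_verts_def)
qed

text \<open>
  If the connecting arrows point towards \<open>0\<close>, the transposed matrix is constructed for the
  opposite tree, where the roles of the two branches are exchanged.
\<close>

lemma idempotent_matrix_exists:
  assumes "x \<noteq> y"
  shows "\<exists>E :: nat \<Rightarrow> nat \<Rightarrow> 'k::field. idempotent_matrix (verts T) (arcs T) (tail T) (head T) F0 F1 E"
proof -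
  interpret fin_digraph T by (rule fin_digraph_T)
  have x0: "x \<in> {0..k}" and y0: "y \<in> {0..k}"
    using x y by auto
  note branch_x = branch_verts_subset[OF x0] branch_arcs_subset[OF x0] branch_arc_ends[OF x0]
  note branch_y = branch_verts_subset[OF y0] branch_arcs_subset[OF y0] branch_arc_ends[OF y0]
  have disj: "verts (S x) \<inter> verts (S y) = {}"
    using assms branches_disjoint[of x y] x y by simp
  have roots: "x \<in> verts (S x)" "y \<in> verts (S y)"
    using root_in_branch x y by auto
  note conn_x = connecting_arc[OF x] and conn_y = connecting_arc[OF y]
  note zero = zero_in_T zero_notin_branch[OF x] zero_notin_branch[OF y]
  have inj_x: "e = e'" if "e \<in> arcs (S x)" "e' \<in> arcs (S x)" "F1 e = F1 e'"
      "tail T e = tail T e' \<or> head T e = head T e'" for e e'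
    using branch_arcs_injective[OF x] that by blast
  have inj_y: "e = e'" if "e \<in> arcs (S y)" "e' \<in> arcs (S y)" "F1 e = F1 e'"
      "tail T e = tail T e' \<or> head T e = head T e'" for e e'
    using branch_arcs_injective[OF y] that by blast
  from ends show ?thesis
  proof
    assume e: "src = (\<lambda>j. 0) \<and> tgt = (\<lambda>j. j)"
    have out: "e \<in> arcs (S i)" if "e \<in> arcs T" "tail T e \<in> verts (S i)" "i \<in> {1..k}" for e i
      using arc_at_branch[of i e] connecting_arc[of i] zero_notin_branch[of i] e that by auto
    show ?thesis
    proof (rule idempotent_matrix_graph[where r = "0::nat" and x = x and y = y and C = C
          and ?V1.0 = "verts (S x)" and ?V2.0 = "verts (S y)"
          and ?A1.0 = "arcs (S x)" and ?A2.0 = "arcs (S y)" and ?a1.0 = "a x" and ?a2.0 = "a y"])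
      show "0 \<in> verts T" "0 \<notin> verts (S x)" "0 \<notin> verts (S y)" by (fact zero)+
      show "verts (S x) \<inter> verts (S y) = {}" using disj by blast
      show "x \<in> verts (S x)" "y \<in> verts (S y)" by (fact roots)+
      show "F1 (a x) = F1 (a y)" using x y by (rule connecting_arcs_same_label)
      show "a x \<in> arcs T" "a y \<in> arcs T" by (fact conn_x conn_y)+
      show "tail T (a x) = 0" "head T (a x) = x" "tail T (a y) = 0" "head T (a y) = y"
        using e conn_x conn_y by simp_all
      show "tail T b \<in> verts (S x) \<and> head T b \<in> verts (S x)" if "b \<in> arcs (S x)" for b
        using branch_x(3,4) that by blast
      show "tail T b \<in> verts (S y) \<and> head T b \<in> verts (S y)" if "b \<in> arcs (S y)" for b
        using branch_y(3,4) that by blast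
      show "b \<in> arcs (S x)" if "b \<in> arcs T" "tail T b \<in> verts (S x)" for b
        using out that x by blast
      show "b \<in> arcs (S y)" if "b \<in> arcs T" "tail T b \<in> verts (S y)" for b
        using out that y by blast
      show "b \<in> arcs (S x) \<or> b = a x" if "b \<in> arcs T" "head T b \<in> verts (S x)" for b
        using arc_at_branch[OF x] that by blast
      show "b \<in> arcs (S y) \<or> b = a y" if "b \<in> arcs T" "head T b \<in> verts (S y)" for b
        using arc_at_branch[OF y] that by blast
      show "b = c" if "b \<in> arcs (S x)" "c \<in> arcs (S x)" "F1 b = F1 c" "tail T b = tail T c" for b c
        using inj_x that by blast
      show "b = c" if "b \<in> arcs (S y)" "c \<in> arcs (S y)" "F1 b = F1 c" "head T b = head T c" for b c
        using inj_y that by blast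
      show "\<exists>c\<in>arcs (S y). head T c = m \<and> F1 b = F1 c \<and> C (tail T b) (tail T c)"
        if "b \<in> arcs (S x)" "C (head T b) m" for b m
        using that by (rule component_incoming)
      show "\<exists>c\<in>arcs (S x). tail T c = n \<and> F1 c = F1 b \<and> C (head T c) (head T b)"
        if "b \<in> arcs (S y)" "C n (tail T b)" for b n
        using that by (rule component_outgoing)
      show "n \<in> verts (S x) \<and> m \<in> verts (S y) \<and> F0 n = F0 m" "n = x \<longleftrightarrow> m = y" if "C n m" for n m
        using component_in_branches[OF that] component_same_vertex[OF that] component_at_root[OF that]
        by simp_all
    qed (fact finite_verts finite_arcs branch_x(1,2) branch_y(1,2) pullback_component.base)+
  next
    assume e: "src = (\<lambda>j. j) \<and> tgt = (\<lambda>j. 0)"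
    have inc: "e \<in> arcs (S i)" if "e \<in> arcs T" "head T e \<in> verts (S i)" "i \<in> {1..k}" for e i
      using arc_at_branch[of i e] connecting_arc[of i] zero_notin_branch[of i] e that by auto
    have "\<exists>E :: nat \<Rightarrow> nat \<Rightarrow> 'k. idempotent_matrix (verts T) (arcs T) (head T) (tail T) F0 F1 E"
    proof (rule idempotent_matrix_graph[where r = "0::nat" and x = y and y = x and C = "\<lambda>m n. C n m"
          and ?V1.0 = "verts (S y)" and ?V2.0 = "verts (S x)"
          and ?A1.0 = "arcs (S y)" and ?A2.0 = "arcs (S x)" and ?a1.0 = "a y" and ?a2.0 = "a x"])
      show "0 \<in> verts T" "0 \<notin> verts (S y)" "0 \<notin> verts (S x)" by (fact zero)+
      show "verts (S y) \<inter> verts (S x) = {}" using disj by blast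
      show "y \<in> verts (S y)" "x \<in> verts (S x)" by (fact roots)+
      show "F1 (a y) = F1 (a x)" using y x by (rule connecting_arcs_same_label)
      show "a y \<in> arcs T" "a x \<in> arcs T" by (fact conn_x conn_y)+
      show "head T (a y) = 0" "tail T (a y) = y" "head T (a x) = 0" "tail T (a x) = x"
        using e conn_x conn_y by simp_all
      show "head T b \<in> verts (S y) \<and> tail T b \<in> verts (S y)" if "b \<in> arcs (S y)" for b
        using branch_y(3,4) that by blast
      show "head T b \<in> verts (S x) \<and> tail T b \<in> verts (S x)" if "b \<in> arcs (S x)" for b
        using branch_x(3,4) that by blast
      show "b \<in> arcs (S y)" if "b \<in> arcs T" "head T b \<in> verts (S y)" for b
        using inc that y by blast
      show "b \<in> arcs (S x)" if "b \<in> arcs T" "head T b \<in> verts (S x)" for b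
        using inc that x by blast
      show "b \<in> arcs (S y) \<or> b = a y" if "b \<in> arcs T" "tail T b \<in> verts (S y)" for b
        using arc_at_branch[OF y] that by blast
      show "b \<in> arcs (S x) \<or> b = a x" if "b \<in> arcs T" "tail T b \<in> verts (S x)" for b
        using arc_at_branch[OF x] that by blast
      show "b = c" if "b \<in> arcs (S y)" "c \<in> arcs (S y)" "F1 b = F1 c" "head T b = head T c" for b c
        using inj_y that by blast
      show "b = c" if "b \<in> arcs (S x)" "c \<in> arcs (S x)" "F1 b = F1 c" "tail T b = tail T c" for b c
        using inj_x that by blast
      \<comment> \<open>\<open>C\<close> is transposed together with the branches, so the two
        lifting properties exchange places.\<close>
      show "\<exists>c\<in>arcs (S x). tail T c = n \<and> F1 b = F1 c \<and> C (head T c) (head T b)"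
        if "b \<in> arcs (S y)" "C n (tail T b)" for b n
        using component_outgoing[OF that] by (simp add: eq_commute)
      show "\<exists>c\<in>arcs (S y). head T c = m \<and> F1 c = F1 b \<and> C (tail T b) (tail T c)"
        if "b \<in> arcs (S x)" "C (head T b) m" for b m
        using component_incoming[OF that] by (simp add: eq_commute)
      show "m \<in> verts (S y) \<and> n \<in> verts (S x) \<and> F0 m = F0 n" "m = y \<longleftrightarrow> n = x" if "C n m" for n m
        using component_in_branches[OF that] component_same_vertex[OF that] component_at_root[OF that]
        by simp_all
    qed (fact finite_verts finite_arcs branch_x(1,2) branch_y(1,2) pullback_component.base)+
    then show ?thesis
      using idempotent_matrix_transpose by blast
  qed
qed

end

text \<open>Common core of both orientations: a preimage of \<open>(x, y)\<close> under
  \<open>forget_sign\<close> fixes the sign with which the component is lifted.\<close>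

lemma decomposable_if_generalised_graph_map:
  fixes Q :: "('v,'q) pre_digraph" and T :: "(nat,'a) pre_digraph"
  assumes "zero_relation_quiver TYPE('k::field) Q \<rho>"
    and "bound_quiver_morphism TYPE('k) T Q \<rho> F0 F1"
    and "branched_tree T k S a src tgt F1"
    and "generalised_graph_map T F0 F1 G"
    and "x \<in> {1..k}" "y \<in> {1..k}" "x \<noteq> y" "(x, y) \<in> forget_sign ` net_verts G"
  shows "decomposable Q \<rho> (tree_module T F0 F1 :: ('k,'v,'q, nat \<Rightarrow>\<^sub>0 'k) rep)"
proof -
  interpret branched_tree T k S a src tgt F1 by fact
  obtain j where j: "(x, y, j) \<in> net_verts G"
    using assms(8) by (auto simp: forget_sign_def)
  interpret complete_branched_tree T k S a src tgt F1 F0 G x y j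
    using assms(4-6) j by unfold_locales (auto simp: generalised_graph_map_def)
  obtain E :: "nat \<Rightarrow> nat \<Rightarrow> 'k" where "idempotent_matrix (verts T) (arcs T) (tail T) (head T) F0 F1 E"
    using idempotent_matrix_exists[OF assms(7)] by blast
  then show ?thesis
    by (rule decomposable_if_idempotent_matrix[OF assms(1) fin_digraph_T assms(2)])
qed

theorem theorem6p4:
  fixes Q :: "('v,'q) pre_digraph" and \<rho> :: "('v,'q) qpath set"
  assumes "CHAR('k::field) \<noteq> 2"
    and "zero_relation_quiver TYPE('k) Q \<rho>"
  shows
    "(\<forall>(T :: (nat,'a) pre_digraph) k S a F0 F1.
        tree_shape T k S a (\<lambda>j. 0) (\<lambda>j. j) \<and>
        bound_quiver_morphism TYPE('k) T Q \<rho> F0 F1 \<and>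
        branches_unramified T k S F1 \<and>
        (\<forall>j\<in>{1..k}. F1 (a 1) = F1 (a j)) \<and>
        (\<forall>b\<in>arcs T. tail T b = 0 \<and> F1 b = F1 (a 1) \<longrightarrow> (\<exists>j\<in>{1..k}. b = a j)) \<and>
        (\<exists>n1\<in>{1..k}. \<exists>n2\<in>{1..k}. n1 \<noteq> n2 \<and>
           (\<exists>G. generalised_graph_map T F0 F1 G \<and> (n1, n2) \<in> forget_sign ` net_verts G)) \<longrightarrow>
        decomposable Q \<rho> (tree_module T F0 F1 :: ('k,'v,'q, nat \<Rightarrow>\<^sub>0 'k) rep)) \<and>
     (\<forall>(T :: (nat,'a) pre_digraph) k S a F0 F1.
        tree_shape T k S a (\<lambda>j. j) (\<lambda>j. 0) \<and>
        bound_quiver_morphism TYPE('k) T Q \<rho> F0 F1 \<and>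
        branches_unramified T k S F1 \<and>
        (\<forall>j\<in>{1..k}. F1 (a 1) = F1 (a j)) \<and>
        (\<forall>b\<in>arcs T. head T b = 0 \<and> F1 b = F1 (a 1) \<longrightarrow> (\<exists>j\<in>{1..k}. b = a j)) \<and>
        (\<exists>n1\<in>{1..k}. \<exists>n2\<in>{1..k}. n1 \<noteq> n2 \<and>
           (\<exists>G. generalised_graph_map T F0 F1 G \<and> (n1, n2) \<in> forget_sign ` net_verts G)) \<longrightarrow>
        decomposable Q \<rho> (tree_module T F0 F1 :: ('k,'v,'q, nat \<Rightarrow>\<^sub>0 'k) rep))"
  by (intro conjI allI impI; elim conjE bexE exE;
      rule decomposable_if_generalised_graph_map[OF assms(2)], assumption,
      rule branched_tree.intro, assumption, simp, assumption+)

end
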